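(* Let $\mu=\phi(x)\,dx$ be a compactly supported absolutely continuous Borel probability measure on $\mathbb{R}^d$ whose density $\phi$ is essentially bounded above and below on the support of $\mu$, i.e. there are constants $0<m\le M<\infty$ with $m\le\phi\le M$ almost everywhere on the support. Then the following hold. (i) There exists an infinite measure of the form $\nu=\sum_{\lambda\in\Lambda_\mu}\delta_\lambda$, with $\Lambda_\mu\subset\mathbb{R}^d$ countable, that is a $(p,q)$-Bessel measure for $\mu$, where $1\le p\le2$ and $q$ is the conjugate exponent to $p$. Moreover, when $\mu$ is a spectral measure, we have $\nu\in\mathcal{B}_1(\mu)_{p,q}$ (for $\Lambda_\mu$ a spectrum of $\mu$), where $1\le p\le2$ and $q$ is the conjugate exponent to $p$. (ii) There exists a $q$-Bessel $\{e_\lambda\}_{\lambda\in\Lambda_\mu}$ for $L^p(\mu)$, where $1<p\le2$ and $q$ is the conjugate exponent to $p$. In addition, when $\mu$ is a spectral measure, $\{e_\lambda\}_{\lambda\in\Lambda_\mu}$ (for $\Lambda_\mu$ a spectrum of $\mu$) is a $q$-Bessel for $L^p(\mu)$ with bound $1$, where $1<p\le2$ and $q$ is the conjugate exponent to $p$.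
   Context: For $t\in\mathbb{R}^d$ let $e_t(x)=e^{2\pi i t\cdot x}$, and let $\delta_\lambda$ be the Dirac measure at $\lambda$. A compactly supported Borel probability measure $\mu$ is spectral (resp. F-spectral) if there is a countable set $\Lambda\subset\mathbb{R}^d$ such that $\{e_\lambda\}_{\lambda\in\Lambda}$ is an orthonormal basis (resp. a frame) for $L^2(\mu)$; then $\Lambda$ is called a spectrum (resp. F-spectrum) of $\mu$. The notation $\Lambda_\mu$ refers to a spectrum or F-spectrum of $\mu$. A measure is infinite if its total mass is $\infty$. For a Borel probability measure $\mu$, $1\le p<\infty$ and $f\in L^p(\mu)$, put $\widehat{f d\mu}(t)=\int f(x)e^{-2\pi i t\cdot x}\,d\mu(x)$. The compatible semi-inner product $[f,g]_{L^p(\mu)}=\|g\|_{L^p(\mu)}^{2-p}\int f|g|^{p-1}\overline{\mathrm{sgn}(g)}\,d\mu$ satisfies $[f,e_t]_{L^p(\mu)}=\widehat{f d\mu}(t)$. For conjugate exponents $1<p,q<\infty$, a Borel measure $\nu$ is a $(p,q)$-Bessel measure for $\mu$ with bound $B>0$ if $\int_{\mathbb{R}^d}|[f,e_t]_{L^p(\mu)}|^q\,d\nu(t)\le B\|f\|_{L^p(\mu)}^q$ for all $f\in L^p(\mu)$; for $p=1$, $q=\infty$, the condition is $\|\widehat{f d\mu}\|_\infty\le B\|f\|_{L^1(\mu)}$ for all $f\in L^1(\mu)$, with the norm of $L^\infty(\nu)$. $\mathcal{B}_B(\mu)_{p,q}$ is the set of all $(p,q)$-Bessel measures for $\mu$ with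 bound $B$. For $1<p,q<\infty$, a sequence $\{f_i\}_{i\in I}$ is a $q$-Bessel for $L^p(\mu)$ with bound $B>0$ if $\sum_{i\in I}|[f,f_i]_{L^p(\mu)}|^q\le B\|f\|_{L^p(\mu)}^q$ for all $f\in L^p(\mu)$. *)

theory Defs
  imports "HOL-Probability.Probability"
begin

definition expo :: "'a::euclidean_space \<Rightarrow> 'a \<Rightarrow> complex" where
  "expo t x = exp (2 * of_real pi * \<i> * of_real (t \<bullet> x))"

definition msupport :: "'a::topological_space measure \<Rightarrow> 'a set" where
  "msupport \<mu> = {x. \<forall>U. open U \<longrightarrow> x \<in> U \<longrightarrow> emeasure \<mu> U > 0}"

text \<open>Elements of \<open>L\<^sup>p\<close> are represented by functions, not by classes modulo null sets;
  the exponent \<open>p\<close> is finite.\<close>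

definition Lp :: "'a measure \<Rightarrow> real \<Rightarrow> ('a \<Rightarrow> complex) set" where
  "Lp \<mu> p = {f \<in> borel_measurable \<mu>. integrable \<mu> (\<lambda>x. cmod (f x) powr p)}"

definition Lp_norm :: "'a measure \<Rightarrow> real \<Rightarrow> ('a \<Rightarrow> complex) \<Rightarrow> real" where
  "Lp_norm \<mu> p f = (\<integral>x. cmod (f x) powr p \<partial>\<mu>) powr (1 / p)"

definition L2_inner :: "'a measure \<Rightarrow> ('a \<Rightarrow> complex) \<Rightarrow> ('a \<Rightarrow> complex) \<Rightarrow> complex" where
  "L2_inner \<mu> f g = (\<integral>x. f x * cnj (g x) \<partial>\<mu>)"

text \<open>Note that \<open>sgn z = z / |z|\<close> and \<open>sgn 0 = 0\<close> for complex \<open>z\<close>.\<close>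

definition semi_inner :: "'a measure \<Rightarrow> real \<Rightarrow> ('a \<Rightarrow> complex) \<Rightarrow> ('a \<Rightarrow> complex) \<Rightarrow> complex" where
  "semi_inner \<mu> p f g =
     of_real (Lp_norm \<mu> p g powr (2 - p)) *
     (\<integral>x. f x * of_real (cmod (g x) powr (p - 1)) * cnj (sgn (g x)) \<partial>\<mu>)"

definition fourier :: "'a::euclidean_space measure \<Rightarrow> ('a \<Rightarrow> complex) \<Rightarrow> 'a \<Rightarrow> complex" where
  "fourier \<mu> f t = (\<integral>x. f x * exp (- (2 * of_real pi * \<i> * of_real (t \<bullet> x))) \<partial>\<mu>)"

text \<open>An orthonormal basis of \<open>L\<^sup>2\<close> is an orthonormal family whose finite linear combinations
  are dense. Sums of nonnegative terms, here and below, are integrals against a counting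
  measure, so that a divergent sum has the value \<open>\<infinity>\<close>.\<close>

definition is_spectrum :: "'a::euclidean_space measure \<Rightarrow> 'a set \<Rightarrow> bool" where
  "is_spectrum \<mu> \<Lambda> \<longleftrightarrow>
     countable \<Lambda> \<and>
     (\<forall>k\<in>\<Lambda>. \<forall>l\<in>\<Lambda>. L2_inner \<mu> (expo k) (expo l) = (if k = l then 1 else 0)) \<and>
     (\<forall>f\<in>Lp \<mu> 2. \<forall>\<epsilon>>0. \<exists>F c. finite F \<and> F \<subseteq> \<Lambda> \<and>
        Lp_norm \<mu> 2 (\<lambda>x. f x - (\<Sum>l\<in>F. c l * expo l x)) < \<epsilon>)"

definition is_F_spectrum :: "'a::euclidean_space measure \<Rightarrow> 'a set \<Rightarrow> bool" where
  "is_F_spectrum \<mu> \<Lambda> \<longleftrightarrow>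
     countable \<Lambda> \<and>
     (\<exists>A>0. \<exists>B>0. \<forall>f\<in>Lp \<mu> 2.
        ennreal (A * (Lp_norm \<mu> 2 f)\<^sup>2)
          \<le> (\<integral>\<^sup>+l. ennreal ((cmod (L2_inner \<mu> f (expo l)))\<^sup>2) \<partial>count_space \<Lambda>) \<and>
        (\<integral>\<^sup>+l. ennreal ((cmod (L2_inner \<mu> f (expo l)))\<^sup>2) \<partial>count_space \<Lambda>)
          \<le> ennreal (B * (Lp_norm \<mu> 2 f)\<^sup>2))"

text \<open>The Borel measure \<open>\<Sum>l\<in>\<Lambda>. \<delta>\<^sub>l\<close>; the library's \<open>return borel l\<close> is the Dirac measure.\<close>

definition dirac_sum :: "'a::topological_space set \<Rightarrow> 'a measure" where
  "dirac_sum \<Lambda> = measure_of UNIV (sets borel)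
     (\<lambda>A. \<integral>\<^sup>+l. emeasure (return borel l) A \<partial>count_space \<Lambda>)"

lemma sets_dirac_sum [simp, measurable_cong]: "sets (dirac_sum \<Lambda>) = sets borel"
  unfolding dirac_sum_def by (metis sets.sets_measure_of_eq space_borel)

text \<open>The set function above is countably additive, so \<open>measure_of\<close> preserves it.\<close>

lemma emeasure_dirac_sum:
  assumes "A \<in> sets borel"
  shows "emeasure (dirac_sum \<Lambda>) A = (\<integral>\<^sup>+l. emeasure (return borel l) A \<partial>count_space \<Lambda>)"
  unfolding dirac_sum_def
proof (rule emeasure_measure_of_sigma)
  show "sigma_algebra UNIV (sets (borel :: 'a measure))"
    by (metis sets.sigma_algebra_axioms space_borel)
  show "countably_additive (sets borel)
    (\<lambda>A. \<integral>\<^sup>+l. emeasure (return borel l) A \<partial>count_space \<Lambda>)"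
  proof (rule countably_additiveI)
    fix A :: "nat \<Rightarrow> 'a set"
    assume *: "range A \<subseteq> sets borel" "disjoint_family A"
    show "(\<Sum>i. \<integral>\<^sup>+l. emeasure (return borel l) (A i) \<partial>count_space \<Lambda>) =
      (\<integral>\<^sup>+l. emeasure (return borel l) (\<Union>i. A i) \<partial>count_space \<Lambda>)"
      using * by (subst nn_integral_suminf[symmetric])
        (auto intro!: nn_integral_cong simp: image_subset_iff suminf_indicator)
  qed
qed (use assms in \<open>auto simp: positive_def\<close>)

text \<open>The set of \<open>(p,q)\<close>-Bessel measures for \<open>\<mu>\<close> with bound \<open>B\<close>. The exponents are meant to be
  conjugate; \<open>p\<close> is finite, and \<open>q = \<infinity>\<close> is the case \<open>p = 1\<close>.\<close>

definition bessel_measures ::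
  "'a::euclidean_space measure \<Rightarrow> real \<Rightarrow> ennreal \<Rightarrow> real \<Rightarrow> 'a measure set" where
  "bessel_measures \<mu> p q B = {\<nu>. sets \<nu> = sets borel \<and> B > 0 \<and>
     (if q = \<infinity> then
        \<forall>f\<in>Lp \<mu> p. esssup \<nu> (\<lambda>t. ennreal (cmod (fourier \<mu> f t))) \<le> ennreal (B * Lp_norm \<mu> p f)
      else
        \<forall>f\<in>Lp \<mu> p. (\<integral>\<^sup>+t. ennreal (cmod (semi_inner \<mu> p f (expo t)) powr enn2real q) \<partial>\<nu>)
          \<le> ennreal (B * Lp_norm \<mu> p f powr enn2real q))}"

definition is_q_bessel ::
  "'a measure \<Rightarrow> real \<Rightarrow> real \<Rightarrow> 'i set \<Rightarrow> ('i \<Rightarrow> 'a \<Rightarrow> complex) \<Rightarrow> real \<Rightarrow> bool" where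
  "is_q_bessel \<mu> p q I f B \<longleftrightarrow> B > 0 \<and> (\<forall>i\<in>I. f i \<in> Lp \<mu> p) \<and>
     (\<forall>g\<in>Lp \<mu> p. (\<integral>\<^sup>+i. ennreal (cmod (semi_inner \<mu> p g (f i)) powr q) \<partial>count_space I)
        \<le> ennreal (B * Lp_norm \<mu> p g powr q))"

end

theory Submission
  imports Defs "HOL-Complex_Analysis.Complex_Analysis"
begin

text \<open>Two facts about \<open>\<mu>\<close> carry the theorem: a Bessel inequality
  \<open>(\<Sum>l\<in>\<Lambda>. |\<langle>f, e\<^sub>l\<rangle>|\<^sup>2) \<le> B \<parallel>f\<parallel>\<^sub>2\<^sup>2\<close>, and the trivial bound \<open>|\<langle>f, e\<^sub>l\<rangle>| \<le> \<parallel>f\<parallel>\<^sub>1\<close>, which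
  holds because the exponentials have modulus one. Interpolating between them with Hadamard's three
  lines theorem yields F. Riesz's form of the Hausdorff--Young inequality,
  \<open>(\<Sum>l\<in>\<Lambda>. |\<langle>f, e\<^sub>l\<rangle>|\<^sup>q) \<le> B \<parallel>f\<parallel>\<^sub>p\<^sup>q\<close> (\<open>riesz_hausdorff_young\<close>). The sum is
  written as a bilinear form in \<open>f\<close> and a dual sequence, and both are embedded in
  analytic families. Since \<open>\<mu>\<close> is a probability measure and \<open>|e\<^sub>l| = 1\<close>, the semi-inner product with \<open>e\<^sub>l\<close> is the plain \<open>L\<^sup>2\<close> pairing, for every \<open>p\<close>; so this
  inequality is both the statement on Bessel measures and the one on \<open>q\<close>-Bessel families, while
  \<open>p = 1\<close> is the trivial bound. For a spectrum, orthonormality gives \<open>B = 1\<close>.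

  What remains is the existence of an F-spectrum. The support of \<open>\<mu>\<close> lies in an open cube of some
  side \<open>2R\<close>, and the classical Fourier basis of that cube, with frequencies in the lattice of mesh
  \<open>1/(2R)\<close>, is a spectrum of the uniform distribution on the cube (\<open>cube_lattice_spectrum\<close>).
  Relative to that distribution, \<open>\<mu>\<close> has a density \<open>\<psi>\<close> that is bounded above and below where
  \<open>\<mu>\<close> lives, and Parseval's identity applied to \<open>\<psi> f\<close> turns these bounds into frame bounds
  (\<open>F_spectrum_of_bounded_density\<close>). The completeness of the Fourier basis is derived from the
  Stone--Weierstrass theorem on the torus and the regularity of Lebesgue measure.

  Finally, a spectrum of a measure without atoms is infinite (\<open>spectrum_infinite\<close>): if it had
  \<open>n\<close> elements, Parseval's identity for an indicator function would bound the measure of every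
  non-null set from below by \<open>1/n\<close>, but small balls around a point of the support violate this.
  This applies to \<open>\<mu>\<close> itself and to the uniform distribution on the cube.\<close>

section \<open>Hadamard's three lines theorem\<close>

text \<open>The maximum modulus principle needs a bounded domain. The factor
  \<open>exp (\<epsilon> (z\<^sup>2 - 1))\<close> has modulus at most \<open>exp (- \<epsilon> (Im z)\<^sup>2)\<close> on the strip, so that the product
  with the bounded function is also small on the horizontal sides of a tall rectangle; then
  \<open>\<epsilon>\<close> tends to zero.\<close>

lemma strip_maximum_modulus:
  assumes holo: "f holomorphic_on {z. 0 < Re z \<and> Re z < 1}"
    and cont: "continuous_on {z. 0 \<le> Re z \<and> Re z \<le> 1} f"
    and bdd: "\<And>z. 0 \<le> Re z \<Longrightarrow> Re z \<le> 1 \<Longrightarrow> cmod (f z) \<le> K"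
    and bdry: "\<And>z. Re z = 0 \<or> Re z = 1 \<Longrightarrow> cmod (f z) \<le> D"
    and D: "0 < D" and w: "0 \<le> Re w" "Re w \<le> 1"
  shows "cmod (f w) \<le> D"
proof -
  have K: "0 \<le> K" using bdd[OF w] norm_ge_zero order_trans by blast
  have damped: "cmod (f w * exp (of_real e * (w\<^sup>2 - 1))) \<le> D" if e: "0 < e" for e :: real
  proof -
    define g where "g z = f z * exp (of_real e * (z\<^sup>2 - 1))" for z
    have Re: "Re (of_real e * (z\<^sup>2 - 1)) = e * ((Re z)\<^sup>2 - 1 - (Im z)\<^sup>2)" for z
      by (simp add: Re_power2)
    have damp: "cmod (g z) \<le> cmod (f z) * exp (- e * (Im z)\<^sup>2)" if "0 \<le> Re z" "Re z \<le> 1" for z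
    proof -
      have "(Re z)\<^sup>2 \<le> 1" using that by (simp add: power_le_one)
      then have "e * ((Re z)\<^sup>2 - 1 - (Im z)\<^sup>2) \<le> e * (- (Im z)\<^sup>2)"
        using e by (intro mult_left_mono) auto
      then show ?thesis unfolding g_def norm_mult norm_exp_eq_Re Re
        by (intro mult_left_mono) auto
    qed
    have "((\<lambda>y. K * exp (- e * y\<^sup>2)) \<longlongrightarrow> 0) at_top"
      using e by real_asymp
    then have "\<forall>\<^sub>F y in at_top. K * exp (- e * y\<^sup>2) < D"
      using D by (rule order_tendstoD)
    then obtain T0 where T0: "\<And>y. y \<ge> T0 \<Longrightarrow> K * exp (- e * y\<^sup>2) < D"
      by (auto simp: eventually_at_top_linorder)
    define T where "T = max T0 (\<bar>Im w\<bar> + 1)"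
    have T: "K * exp (- e * T\<^sup>2) < D" "\<bar>Im w\<bar> < T"
      using T0[of T] unfolding T_def by auto
    define S where "S = cbox (Complex 0 (-T)) (Complex 1 T)"
    have S: "z \<in> S \<longleftrightarrow> 0 \<le> Re z \<and> Re z \<le> 1 \<and> -T \<le> Im z \<and> Im z \<le> T" for z
      by (auto simp: S_def in_cbox_complex_iff)
    have iS: "interior S = box (Complex 0 (-T)) (Complex 1 T)"
      unfolding S_def by (rule interior_cbox)
    show ?thesis unfolding g_def[symmetric]
    proof (rule maximum_modulus_frontier[of g S])
      show "w \<in> S" using w T by (auto simp: S)
      show "bounded S" by (simp add: S_def bounded_cbox)
      show "g holomorphic_on interior S"
        unfolding g_def iS
        by (intro holomorphic_intros holomorphic_on_subset[OF holo]) (auto simp: in_box_complex_iff)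
      have "closure S = S" unfolding S_def by (intro closure_closed closed_cbox)
      then show "continuous_on (closure S) g"
        unfolding g_def by (auto intro!: continuous_intros continuous_on_subset[OF cont] simp: S)
      fix z assume "z \<in> frontier S"
      then have zS: "z \<in> S" and "z \<notin> interior S"
        by (auto simp: frontier_def \<open>closure S = S\<close>)
      then consider "Re z = 0 \<or> Re z = 1" | "\<bar>Im z\<bar> = T"
        by (force simp: iS S in_box_complex_iff)
      then show "cmod (g z) \<le> D"
      proof cases
        case 1
        have "cmod (g z) \<le> cmod (f z) * exp (- e * (Im z)\<^sup>2)"
          using zS by (intro damp) (auto simp: S)
        also have "\<dots> \<le> D * 1" using bdry[OF 1] e D by (intro mult_mono) auto
        finally show ?thesis by simp
      next
        case 2
        then have "(Im z)\<^sup>2 = T\<^sup>2" by (metis power2_abs)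
        have "cmod (g z) \<le> cmod (f z) * exp (- e * (Im z)\<^sup>2)"
          using zS by (intro damp) (auto simp: S)
        also have "\<dots> \<le> K * exp (- e * T\<^sup>2)"
          unfolding \<open>(Im z)\<^sup>2 = T\<^sup>2\<close> using bdd zS by (intro mult_right_mono) (auto simp: S)
        finally show ?thesis using T by simp
      qed
    qed
  qed
  have "((\<lambda>e::real. f w * exp (of_real e * (w\<^sup>2 - 1))) \<longlongrightarrow> f w * exp (of_real 0 * (w\<^sup>2 - 1))) (at_right 0)"
    by (intro tendsto_intros)
  then have "((\<lambda>e::real. cmod (f w * exp (of_real e * (w\<^sup>2 - 1)))) \<longlongrightarrow> cmod (f w)) (at_right 0)"
    by (auto dest: tendsto_norm)
  moreover have "\<forall>\<^sub>F e in at_right 0. cmod (f w * exp (of_real e * (w\<^sup>2 - 1))) \<le> D"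
    using damped by (auto simp: eventually_at_right_less intro: eventually_mono[OF eventually_at_right_less])
  ultimately show ?thesis
    by (rule tendsto_upperbound) auto
qed

text \<open>Multiplication by \<open>M0 powr (z - 1) * M1 powr (- z)\<close> normalises both boundary bounds to
  one.\<close>

proposition hadamard_three_lines:
  assumes holo: "f holomorphic_on {z. 0 < Re z \<and> Re z < 1}"
    and cont: "continuous_on {z. 0 \<le> Re z \<and> Re z \<le> 1} f"
    and bdd: "\<And>z. 0 \<le> Re z \<Longrightarrow> Re z \<le> 1 \<Longrightarrow> cmod (f z) \<le> K"
    and left: "\<And>z. Re z = 0 \<Longrightarrow> cmod (f z) \<le> M0"
    and right: "\<And>z. Re z = 1 \<Longrightarrow> cmod (f z) \<le> M1"
    and M: "0 < M0" "0 < M1" and w: "0 \<le> Re w" "Re w \<le> 1"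
  shows "cmod (f w) \<le> M0 powr (1 - Re w) * M1 powr Re w"
proof -
  define h :: "complex \<Rightarrow> complex" where "h z = exp (of_real (ln M0) * (z - 1) - of_real (ln M1) * z)" for z
  have norm_h: "cmod (h z) = exp (ln M0 * (Re z - 1) - ln M1 * Re z)" for z
    by (simp add: h_def)
  have "cmod (f w * h w) \<le> 1"
  proof (rule strip_maximum_modulus[OF _ _ _ _ zero_less_one w])
    show "(\<lambda>z. f z * h z) holomorphic_on {z. 0 < Re z \<and> Re z < 1}"
      unfolding h_def by (intro holomorphic_intros holo)
    show "continuous_on {z. 0 \<le> Re z \<and> Re z \<le> 1} (\<lambda>z. f z * h z)"
      unfolding h_def by (intro continuous_intros cont)
    fix z
    show "cmod (f z * h z) \<le> K * exp (\<bar>ln M0\<bar> + \<bar>ln M1\<bar>)" if z: "0 \<le> Re z" "Re z \<le> 1"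
    proof -
      have "ln M0 * (Re z - 1) \<le> \<bar>ln M0\<bar> * 1" "- (ln M1 * Re z) \<le> \<bar>ln M1\<bar> * 1"
        using z mult_mono[of "\<bar>ln M0\<bar>" "\<bar>ln M0\<bar>" "\<bar>Re z - 1\<bar>" 1]
          mult_mono[of "\<bar>ln M1\<bar>" "\<bar>ln M1\<bar>" "\<bar>Re z\<bar>" 1] 
          abs_ge_self[of "ln M0 * (Re z - 1)"] abs_ge_minus_self[of "ln M1 * Re z"]
        by (auto simp: abs_mult)
      then have "cmod (h z) \<le> exp (\<bar>ln M0\<bar> + \<bar>ln M1\<bar>)"
        by (simp add: norm_h)
      moreover have "0 \<le> K" using bdd[OF z] norm_ge_zero order_trans by blast
      ultimately show ?thesis using bdd[OF z] by (simp add: norm_mult mult_mono)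
    qed
    show "cmod (f z * h z) \<le> 1" if "Re z = 0 \<or> Re z = 1"
      using that
    proof
      assume z: "Re z = 0"
      have "cmod (h z) = 1 / M0" using M by (simp add: norm_h z exp_minus field_simps)
      then show ?thesis using left[OF z] M by (simp add: norm_mult divide_le_eq_1)
    next
      assume z: "Re z = 1"
      have "cmod (h z) = 1 / M1" using M by (simp add: norm_h z exp_minus field_simps)
      then show ?thesis using right[OF z] M by (simp add: norm_mult divide_le_eq_1)
    qed
  qed
  moreover have "cmod (h w) * (M0 powr (1 - Re w) * M1 powr Re w) = 1"
    using M by (simp add: norm_h powr_def exp_add[symmetric] algebra_simps)
  ultimately show ?thesis using M
    by (smt (verit) mult_left_le_imp_le mult.commute mult.left_commute norm_mult mult_pos_pos powr_gt_zero
        mult_right_mono mult_1 norm_ge_zero)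
qed

section \<open>Riesz interpolation: the Hausdorff--Young inequality\<close>

lemma measurable_cnj [measurable (raw)]:
  "f \<in> borel_measurable M \<Longrightarrow> (\<lambda>x. cnj (f x)) \<in> borel_measurable M"
  by (rule measurable_compose[OF _ borel_measurable_continuous_onI]) (auto intro: continuous_intros)

lemma sum_le_nn_integral_count_space:
  assumes "F \<subseteq> I" "finite F"
  shows "(\<Sum>i\<in>F. f i) \<le> (\<integral>\<^sup>+i. f i \<partial>count_space I)"
proof -
  have "(\<Sum>i\<in>F. f i) = (\<Sum>i\<in>F. f i * indicator F i)"
    by (intro sum.cong) auto
  also have "\<dots> = (\<integral>\<^sup>+i. f i * indicator F i \<partial>count_space I)"
    using assms by (intro nn_integral_count_space'[symmetric]) auto
  also have "\<dots> \<le> (\<integral>\<^sup>+i. f i \<partial>count_space I)"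
    by (intro nn_integral_mono) (auto split: split_indicator)
  finally show ?thesis .
qed

text \<open>An integral against a counting measure is the supremum of the finite partial sums; with
  countability, this reduces to series over the natural numbers.\<close>

lemma nn_integral_count_space_leI:
  fixes f :: "'i \<Rightarrow> ennreal"
  assumes I: "countable I" and le: "\<And>F. finite F \<Longrightarrow> F \<subseteq> I \<Longrightarrow> (\<Sum>i\<in>F. f i) \<le> C"
  shows "(\<integral>\<^sup>+i. f i \<partial>count_space I) \<le> C"
proof (cases "finite I")
  case True
  then show ?thesis using le by (simp add: nn_integral_count_space_finite)
next
  case False
  have bij: "bij_betw (from_nat_into I) UNIV I"
    using I False by (rule bij_betw_from_nat_into)
  have "(\<integral>\<^sup>+i. f i \<partial>count_space I) = (\<Sum>n. f (from_nat_into I n))"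
    by (simp add: nn_integral_bij_count_space[symmetric, OF bij] nn_integral_count_space_nat)
  also have "\<dots> = (SUP n. \<Sum>k<n. f (from_nat_into I k))"
    by (rule suminf_eq_SUP)
  also have "\<dots> \<le> C"
  proof (rule SUP_least)
    fix n
    have "(\<Sum>k<n. f (from_nat_into I k)) = (\<Sum>i\<in>from_nat_into I ` {..<n}. f i)"
      using bij by (subst sum.reindex) (auto simp: bij_betw_def intro: inj_on_subset)
    also have "\<dots> \<le> C"
      using bij by (intro le) (auto simp: bij_betw_def)
    finally show "(\<Sum>k<n. f (from_nat_into I k)) \<le> C" .
  qed
  finally show ?thesis .
qed

text \<open>The analytic family \<open>|a| powr (p (1 - z / 2)) sgn a\<close>: its modulus is \<open>|a| powr p\<close> on the line
  \<open>Re z = 0\<close> and \<open>|a| powr (p / 2)\<close> on the line \<open>Re z = 1\<close>, and it passes through \<open>a\<close> where the exponent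
  is one. For \<open>a = 0\<close> the factor \<open>sgn a\<close> makes it vanish, whatever the value of \<open>ln 0\<close>.\<close>

definition cpow :: "complex \<Rightarrow> real \<Rightarrow> complex \<Rightarrow> complex" where
  "cpow a p z = sgn a * exp (of_real (p * ln (cmod a)) * (1 - z / 2))"

lemma norm_cpow: "cmod (cpow a p z) = cmod a powr (p * (1 - Re z / 2))"
  by (cases "a = 0") (simp_all add: cpow_def norm_mult norm_sgn powr_def algebra_simps)

lemma cpow_at_inverse_exponent: "1 - Re z / 2 = 1 / p \<Longrightarrow> Im z = 0 \<Longrightarrow> p \<noteq> 0 \<Longrightarrow> cpow a p z = a"
proof -
  assume z: "1 - Re z / 2 = 1 / p" "Im z = 0" "p \<noteq> 0"
  then have "1 - z / 2 = of_real (1 / p)"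
    by (auto simp: complex_eq_iff)
  then have "cpow a p z = sgn a * exp (of_real (ln (cmod a)))"
    using z by (simp add: cpow_def del: of_real_divide) (simp add: of_real_divide)
  then show ?thesis
    by (cases "a = 0") (simp_all add: exp_of_real sgn_div_norm scaleR_conv_of_real)
qed

lemma norm_cpow_le:
  assumes "0 \<le> Re z" "Re z \<le> 1"
  shows "cmod (cpow a p z) \<le> exp \<bar>p * ln (cmod a)\<bar>"
proof (cases "a = 0")
  case False
  have "p * ln (cmod a) * (1 - Re z / 2) \<le> \<bar>p * ln (cmod a)\<bar> * \<bar>1 - Re z / 2\<bar>"
    by (metis abs_ge_self abs_mult)
  also have "\<dots> \<le> \<bar>p * ln (cmod a)\<bar> * 1"
    using assms by (intro mult_left_mono) auto
  finally show ?thesis using False by (simp add: norm_cpow powr_def algebra_simps)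
qed (simp add: cpow_def)

lemma cpow_holomorphic: "cpow a p holomorphic_on S"
  unfolding cpow_def by (intro holomorphic_intros) auto

lemma cauchy_schwarz_sum_norm:
  fixes b a :: "'i \<Rightarrow> complex"
  shows "cmod (\<Sum>i\<in>F. b i * a i) \<le> sqrt (\<Sum>i\<in>F. (cmod (b i))\<^sup>2) * sqrt (\<Sum>i\<in>F. (cmod (a i))\<^sup>2)"
proof -
  have "cmod (\<Sum>i\<in>F. b i * a i) \<le> (\<Sum>i\<in>F. cmod (b i) * cmod (a i))"
    by (rule order_trans[OF norm_sum]) (simp add: norm_mult)
  also have "\<dots> \<le> L2_set (\<lambda>i. cmod (b i)) F * L2_set (\<lambda>i. cmod (a i)) F"
    using L2_set_mult_ineq[of "\<lambda>i. cmod (b i)" "\<lambda>i. cmod (a i)" F] by simp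
  finally show ?thesis by (simp add: L2_set_def)
qed

text \<open>For a simple \<open>f\<close> this turns an integral that depends on a parameter through \<open>g\<close> into a finite
  sum, in which the analytic dependence on the parameter is evident.\<close>

lemma integral_simple_compose:
  fixes f :: "'a \<Rightarrow> complex" and v :: "'a \<Rightarrow> complex"
  assumes f: "simple_function M f" and v: "integrable M v"
  shows "integrable M (\<lambda>x. g (f x) * v x)"
    and "(\<integral>x. g (f x) * v x \<partial>M)
      = (\<Sum>y\<in>f ` space M. g y * (\<integral>x. indicator (f -` {y} \<inter> space M) x * v x \<partial>M))"
proof -
  have fin: "finite (f ` space M)" and meas: "f -` {y} \<inter> space M \<in> sets M" for y
    using f by (auto intro: simple_functionD)
  have eq: "g (f x) * v x = (\<Sum>y\<in>f ` space M. g y * (indicator (f -` {y} \<inter> space M) x * v x))"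
    if "x \<in> space M" for x
    using fin that by (subst sum.remove[of _ "f x"]) (auto intro!: sum.neutral simp: indicator_def)
  have int: "integrable M (\<lambda>x. indicator (f -` {y} \<inter> space M) x * v x)" for y
    using integrable_mult_indicator[OF meas v, of y] by (simp add: indicator_scaleR_eq_if[symmetric] scaleR_conv_of_real of_real_indicator)
  show "integrable M (\<lambda>x. g (f x) * v x)"
    by (subst Bochner_Integration.integrable_cong[OF refl eq])
      (auto intro!: integrable_mult_right int)
  show "(\<integral>x. g (f x) * v x \<partial>M)
      = (\<Sum>y\<in>f ` space M. g y * (\<integral>x. indicator (f -` {y} \<inter> space M) x * v x \<partial>M))"
    by (subst Bochner_Integration.integral_cong[OF refl eq], assumption,
        subst Bochner_Integration.integral_sum)
      (auto intro!: integrable_mult_right int)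
qed

text \<open>The two endpoint bounds of the interpolation: the pointwise bound by one is the
  \<open>L\<^sup>1\<close>-\<open>L\<^sup>\<infinity>\<close> estimate, and the inequality with the constant \<open>B\<close> is the \<open>L\<^sup>2\<close> estimate.\<close>

definition bessel_family :: "'a measure \<Rightarrow> 'i set \<Rightarrow> ('i \<Rightarrow> 'a \<Rightarrow> complex) \<Rightarrow> real \<Rightarrow> bool" where
  "bessel_family M I u B \<longleftrightarrow> (\<forall>i\<in>I. u i \<in> borel_measurable M) \<and> (\<forall>i\<in>I. \<forall>x. cmod (u i x) \<le> 1) \<and>
     (\<forall>F f. finite F \<longrightarrow> F \<subseteq> I \<longrightarrow> f \<in> Lp M 2 \<longrightarrow>
        (\<Sum>i\<in>F. (cmod (L2_inner M f (u i)))\<^sup>2) \<le> B * (\<integral>x. (cmod (f x))\<^sup>2 \<partial>M))"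

text \<open>With \<open>A\<close> and \<open>S\<close> the \<open>p\<close>-th powers of the norms of \<open>f\<close> and \<open>b\<close>, replacing \<open>f\<close> and \<open>b\<close> by their
  analytic families gives a function \<open>\<Phi>\<close> on the strip with \<open>|\<Phi>| \<le> S A\<close> on the left line, by the pointwise
  bound on \<open>u\<close>, and \<open>|\<Phi>| \<le> \<surd>S \<surd>(B A)\<close> on the right line, by the Cauchy--Schwarz and Bessel
  inequalities. The same exponent \<open>p\<close> serves for \<open>f\<close> and for \<open>b\<close>, since \<open>b\<close> is dual to a sequence
  in \<open>\<ell>\<^sup>q\<close>. At \<open>w = 2 - 2 / p\<close> the original bilinear form reappears.\<close>

lemma (in finite_measure) riesz_bilinear_simple:
  fixes f :: "'a \<Rightarrow> complex" and b :: "'i \<Rightarrow> complex"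
  assumes u: "bessel_family M I u B" and B: "0 < B" and F: "finite F" "F \<subseteq> I"
    and f: "simple_function M f" and p: "1 < p" "p \<le> 2"
  shows "cmod (\<Sum>i\<in>F. b i * L2_inner M f (u i))
    \<le> B powr (1 - 1 / p) * (\<integral>x. cmod (f x) powr p \<partial>M) powr (1 / p) * (\<Sum>i\<in>F. cmod (b i) powr p) powr (1 / p)"
proof -
  define A where "A = (\<integral>x. cmod (f x) powr p \<partial>M)"
  define S where "S = (\<Sum>i\<in>F. cmod (b i) powr p)"
  have [measurable]: "f \<in> borel_measurable M" using f by (rule borel_measurable_simple_function)
  have um[measurable]: "u i \<in> borel_measurable M" if "i \<in> F" for i
    using u F that by (auto simp: bessel_family_def)
  have u1: "cmod (u i x) \<le> 1" if "i \<in> F" for i x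
    using u F that by (auto simp: bessel_family_def)
  have int_u: "integrable M (\<lambda>x. cnj (u i x))" if "i \<in> F" for i
    using u1[OF that] um[OF that] by (intro integrable_const_bound[of _ 1]) auto
  have int_simple: "integrable M (\<lambda>x. h (cmod (f x)))" for h :: "real \<Rightarrow> real"
  proof -
    have "simple_function M (\<lambda>x. h (cmod (f x)))"
      using f by (rule simple_function_compose1)
    then show ?thesis
      by (intro integrable_simple_function) (auto simp: less_top)
  qed
  have AS0: "0 \<le> A" "0 \<le> S" unfolding A_def S_def by (auto intro: sum_nonneg)
  show ?thesis
  proof (cases "A = 0 \<or> S = 0")
    case True
    then have "(\<Sum>i\<in>F. b i * L2_inner M f (u i)) = 0"
    proof
      assume "A = 0"
      then have "AE x in M. cmod (f x) powr p = 0"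
        unfolding A_def by (subst (asm) integral_nonneg_eq_0_iff_AE) (auto intro: int_simple)
      then have ae: "AE x in M. f x = 0" by simp
      have "L2_inner M f (u i) = 0" if "i \<in> F" for i
        unfolding L2_inner_def using ae by (intro integral_eq_zero_AE) auto
      then show ?thesis by simp
    next
      assume "S = 0"
      then have "\<forall>i\<in>F. b i = 0"
        unfolding S_def using F by (subst (asm) sum_nonneg_eq_0_iff) auto
      then show ?thesis by simp
    qed
    then show ?thesis by simp
  next
    case False
    with AS0 have AS: "0 < A" "0 < S" by auto
    define \<kappa> where "\<kappa> i y = (\<integral>x. indicator (f -` {y} \<inter> space M) x * cnj (u i x) \<partial>M)" for i y
    define \<Phi> where "\<Phi> z = (\<Sum>i\<in>F. cpow (b i) p z * (\<Sum>y\<in>f ` space M. cpow y p z * \<kappa> i y))" for z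
    have \<Phi>: "\<Phi> z = (\<Sum>i\<in>F. cpow (b i) p z * L2_inner M (\<lambda>x. cpow (f x) p z) (u i))" for z
      unfolding \<Phi>_def L2_inner_def \<kappa>_def
      by (intro sum.cong refl arg_cong2[where f="(*)"] integral_simple_compose(2)[symmetric] f int_u)
    \<comment> \<open>The point where the exponent \<open>p (1 - z / 2)\<close> equals one.\<close>
    define w where "w = complex_of_real (2 - 2 / p)"
    have w: "0 \<le> Re w" "Re w \<le> 1" "1 - Re w / 2 = 1 / p" "Im w = 0"
      using p by (auto simp: w_def field_simps)
    have "cmod (\<Phi> w) \<le> (S * A) powr (1 - Re w) * (sqrt S * sqrt (B * A)) powr Re w"
    proof (rule hadamard_three_lines)
      show "\<Phi> holomorphic_on {z. 0 < Re z \<and> Re z < 1}"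
        unfolding \<Phi>_def by (intro holomorphic_intros cpow_holomorphic)
      show "continuous_on {z. 0 \<le> Re z \<and> Re z \<le> 1} \<Phi>"
        unfolding \<Phi>_def by (intro holomorphic_on_imp_continuous_on holomorphic_intros cpow_holomorphic)
      show "0 < S * A" "0 < sqrt S * sqrt (B * A)" using AS B by auto
      show "0 \<le> Re w" "Re w \<le> 1" by fact+
      fix z
      show "cmod (\<Phi> z) \<le> (\<Sum>i\<in>F. exp \<bar>p * ln (cmod (b i))\<bar> *
          (\<Sum>y\<in>f ` space M. exp \<bar>p * ln (cmod y)\<bar> * cmod (\<kappa> i y)))"
        if "0 \<le> Re z" "Re z \<le> 1"
        unfolding \<Phi>_def using that
        by (intro sum_norm_le) (auto simp: norm_mult intro!: mult_mono norm_cpow_le sum_norm_le)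
      show "cmod (\<Phi> z) \<le> S * A" if z: "Re z = 0"
      proof -
        have "cmod (L2_inner M (\<lambda>x. cpow (f x) p z) (u i)) \<le> A" if "i \<in> F" for i
        proof -
          have "cmod (L2_inner M (\<lambda>x. cpow (f x) p z) (u i)) \<le> (\<integral>x. cmod (cpow (f x) p z * cnj (u i x)) \<partial>M)"
            unfolding L2_inner_def by (rule integral_norm_bound)
          also have "\<dots> \<le> A" unfolding A_def
          proof (rule integral_mono)
            show "integrable M (\<lambda>x. cmod (cpow (f x) p z * cnj (u i x)))"
              by (intro integrable_norm integral_simple_compose(1) f int_u that)
            show "integrable M (\<lambda>x. cmod (f x) powr p)" by (rule int_simple)
            show "cmod (cpow (f x) p z * cnj (u i x)) \<le> cmod (f x) powr p" for x
              using u1[OF that, of x] by (simp add: norm_mult norm_cpow z mult_left_le)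
          qed
          finally show ?thesis .
        qed
        then show ?thesis unfolding \<Phi> S_def sum_distrib_right
          by (intro sum_norm_le) (auto simp: norm_mult norm_cpow z intro!: mult_left_mono)
      qed
      show "cmod (\<Phi> z) \<le> sqrt S * sqrt (B * A)" if z: "Re z = 1"
      proof -
        have half: "(cmod (cpow c p z))\<^sup>2 = cmod c powr p" for c
          by (simp add: norm_cpow z power2_eq_square powr_add[symmetric])
        have pow2: "cmod (cpow c p z) powr 2 = cmod c powr p" for c
          using half by (simp add: powr_numeral)
        have "(\<lambda>x. cpow (f x) p z) \<in> Lp M 2"
          unfolding Lp_def mem_Collect_eq pow2
          using simple_function_compose1[OF f, of "\<lambda>c. cpow c p z"]
          by (intro conjI int_simple borel_measurable_simple_function)
        then have "(\<Sum>i\<in>F. (cmod (L2_inner M (\<lambda>x. cpow (f x) p z) (u i)))\<^sup>2)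
            \<le> B * (\<integral>x. (cmod (cpow (f x) p z))\<^sup>2 \<partial>M)"
          using u F unfolding bessel_family_def by blast
        also have "\<dots> = B * A" by (simp only: half A_def)
        finally have "(\<Sum>i\<in>F. (cmod (L2_inner M (\<lambda>x. cpow (f x) p z) (u i)))\<^sup>2) \<le> B * A" .
        moreover have "(\<Sum>i\<in>F. (cmod (cpow (b i) p z))\<^sup>2) = S"
          by (simp add: half S_def)
        ultimately show ?thesis
          unfolding \<Phi> using AS0
          by (intro order_trans[OF cauchy_schwarz_sum_norm]) (auto intro!: mult_mono sum_nonneg)
      qed
    qed
    also have "\<Phi> w = (\<Sum>i\<in>F. b i * L2_inner M f (u i))"
      unfolding \<Phi> using w p by (simp add: cpow_at_inverse_exponent)
    also have "(S * A) powr (1 - Re w) * (sqrt S * sqrt (B * A)) powr Re w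
        = B powr (1 - 1 / p) * A powr (1 / p) * S powr (1 / p)"
    proof -
      define t where "t = Re w"
      have "(S * A) powr (1 - t) * (sqrt S * sqrt (B * A)) powr t
        = B powr (t / 2) * (A powr (1 - t) * A powr (t/2)) * (S powr (1 - t) * S powr (t/2))"
        using AS B by (simp add: powr_half_sqrt[symmetric] powr_mult powr_powr)
      also have "\<dots> = B powr (t / 2) * A powr (1 - t / 2) * S powr (1 - t / 2)"
        by (simp add: powr_add[symmetric])
      finally have *: "(S * A) powr (1 - t) * (sqrt S * sqrt (B * A)) powr t
        = B powr (t / 2) * A powr (1 - t / 2) * S powr (1 - t / 2)" .
      have t: "1 - t / 2 = 1 / p" "t / 2 = 1 - 1 / p" using w unfolding t_def by auto
      show ?thesis using * unfolding t unfolding t_def by simp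
    qed
    finally show ?thesis by (simp only: A_def S_def)
  qed
qed

text \<open>The extremal dual sequence is \<open>b\<^sub>i = |a\<^sub>i| powr (q - 1) cnj (sgn a\<^sub>i)\<close>, for which
  \<open>b\<^sub>i a\<^sub>i = |a\<^sub>i| powr q = |b\<^sub>i| powr p\<close>.\<close>

lemma (in finite_measure) riesz_simple:
  fixes f :: "'a \<Rightarrow> complex"
  assumes u: "bessel_family M I u B" and B: "0 < B" and F: "finite F" "F \<subseteq> I"
    and f: "simple_function M f" and p: "1 < p" "p \<le> 2" and pq: "1 / p + 1 / q = 1"
  shows "(\<Sum>i\<in>F. cmod (L2_inner M f (u i)) powr q) \<le> B * (\<integral>x. cmod (f x) powr p \<partial>M) powr (q / p)"
proof -
  define A where "A = (\<integral>x. cmod (f x) powr p \<partial>M)"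
  have A: "0 \<le> A" unfolding A_def by auto
  define a where "a i = L2_inner M f (u i)" for i
  define s where "s = (\<Sum>i\<in>F. cmod (a i) powr q)"
  have q0: "q \<noteq> 0" using pq p by (intro notI) auto
  have q: "1 / q = 1 - 1 / p" "0 < q" "(q - 1) * p = q"
  proof -
    show *: "1 / q = 1 - 1 / p" using pq by simp
    have "0 < 1 / q" unfolding * using p by simp
    then show "0 < q" by simp
    show "(q - 1) * p = q" using pq q0 p by (simp add: field_simps)
  qed
  have "s \<le> B * A powr (q / p)"
  proof (cases "s = 0")
    case False
    then have s: "0 < s" unfolding s_def by (simp add: order_less_le sum_nonneg)
    define b where "b i = of_real (cmod (a i) powr (q - 1)) * cnj (sgn (a i))" for i
    have norm_b: "cmod (b i) powr p = cmod (a i) powr q" for i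
      using q by (cases "a i = 0") (auto simp: b_def norm_mult norm_sgn powr_powr)
    have ba: "b i * a i = of_real (cmod (a i) powr q)" for i
    proof (cases "a i = 0")
      case False
      have "cnj (sgn (a i)) * a i = of_real (cmod (a i))"
        using False by (simp add: sgn_div_norm scaleR_conv_of_real complex_norm_square[symmetric] mult.commute
            power2_eq_square divide_simps flip: of_real_mult)
      then have "b i * a i = of_real (cmod (a i) powr (q - 1) * cmod (a i) powr 1)"
        using False by (simp add: b_def mult.assoc)
      then show ?thesis by (simp only: powr_add[symmetric]) simp
    qed simp
    have "cmod (\<Sum>i\<in>F. b i * a i) = s"
    proof -
      have "(\<Sum>i\<in>F. b i * a i) = of_real s" by (simp add: ba s_def)
      then show ?thesis using s by simp
    qed
    then have "s \<le> B powr (1 - 1 / p) * A powr (1 / p) * s powr (1 / p)"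
      using riesz_bilinear_simple[OF u B F f p, of b] by (simp add: norm_b a_def[symmetric] s_def[symmetric] A_def[symmetric])
    then have "s powr (1 / q) * s powr (1 / p) \<le> B powr (1 / q) * A powr (1 / p) * s powr (1 / p)"
      using s by (simp add: powr_add[symmetric] q)
    then have "s powr (1 / q) \<le> B powr (1 / q) * A powr (1 / p)"
      using s by simp
    then have "(s powr (1 / q)) powr q \<le> (B powr (1 / q) * A powr (1 / p)) powr q"
      using q by (intro powr_mono2) auto
    then show ?thesis using s B A q(2) by (simp add: powr_powr powr_mult)
  qed (use B in simp)
  then show ?thesis by (simp add: s_def a_def A_def)
qed

lemma (in finite_measure) Lp_imp_integrable:
  assumes f: "f \<in> Lp M p" and p: "1 \<le> p"
  shows "integrable M f"
proof (rule Bochner_Integration.integrable_bound)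
  show "integrable M (\<lambda>x. 1 + cmod (f x) powr p)" using f by (auto simp: Lp_def)
  show "f \<in> borel_measurable M" using f by (auto simp: Lp_def)
  have "cmod (f x) \<le> 1 + cmod (f x) powr p" for x
  proof (cases "cmod (f x) \<le> 1")
    case False
    then have "cmod (f x) powr 1 \<le> cmod (f x) powr p" using p by (intro powr_mono) auto
    then show ?thesis by auto
  qed (simp add: add_increasing2)
  then show "AE x in M. norm (f x) \<le> norm (1 + cmod (f x) powr p)" by (auto simp: abs_of_nonneg add_nonneg_nonneg)
qed

text \<open>A function in \<open>L\<^sup>p\<close> is the pointwise limit of simple functions dominated by \<open>2 |f|\<close>, so for every
  finite set of indices both sides converge.\<close>

proposition (in finite_measure) riesz_hausdorff_young:
  fixes f :: "'a \<Rightarrow> complex"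
  assumes I: "countable I" and u: "bessel_family M I u B" and B: "0 < B"
    and f: "f \<in> Lp M p" and p: "1 < p" "p \<le> 2" and pq: "1 / p + 1 / q = 1"
  shows "(\<integral>\<^sup>+i. ennreal (cmod (L2_inner M f (u i)) powr q) \<partial>count_space I) \<le> ennreal (B * Lp_norm M p f powr q)"
proof -
  have "1 / q = 1 - 1 / p" using pq by simp
  then have "0 < 1 / q" using p by simp
  then have q: "0 < q" by simp
  have [measurable]: "f \<in> borel_measurable M" and intp: "integrable M (\<lambda>x. cmod (f x) powr p)"
    using f by (auto simp: Lp_def)
  obtain s where s: "\<And>n. simple_function M (s n)"
    and lim: "\<And>x. x \<in> space M \<Longrightarrow> (\<lambda>n. s n x) \<longlonglongrightarrow> f x"
    and dom: "\<And>n x. x \<in> space M \<Longrightarrow> cmod (s n x) \<le> 2 * cmod (f x)"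
    using borel_measurable_implies_sequence_metric[OF \<open>f \<in> borel_measurable M\<close>, of 0]
    unfolding dist_0_norm dist_norm diff_zero by blast
  have [measurable]: "s n \<in> borel_measurable M" for n using s by (rule borel_measurable_simple_function)
  have limp: "(\<lambda>n. \<integral>x. cmod (s n x) powr p \<partial>M) \<longlonglongrightarrow> (\<integral>x. cmod (f x) powr p \<partial>M)"
  proof (rule integral_dominated_convergence)
    show "integrable M (\<lambda>x. 2 powr p * cmod (f x) powr p)" using intp by simp
    show "AE x in M. (\<lambda>n. cmod (s n x) powr p) \<longlonglongrightarrow> cmod (f x) powr p"
      using lim p by (intro AE_I2 tendsto_powr' tendsto_norm tendsto_const) auto
    show "AE x in M. norm (cmod (s n x) powr p) \<le> 2 powr p * cmod (f x) powr p" for n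
      using powr_mono2[OF _ _ dom, of p] p by (auto simp: powr_mult)
  qed measurable
  have fin: "(\<Sum>i\<in>F. cmod (L2_inner M f (u i)) powr q) \<le> B * Lp_norm M p f powr q"
    if F: "finite F" "F \<subseteq> I" for F
  proof -
    have "(\<lambda>n. L2_inner M (s n) (u i)) \<longlonglongrightarrow> L2_inner M f (u i)" if i: "i \<in> F" for i
      unfolding L2_inner_def
    proof (rule integral_dominated_convergence)
      have [measurable]: "u i \<in> borel_measurable M" and u1: "\<And>x. cmod (u i x) \<le> 1"
        using u F i by (auto simp: bessel_family_def)
      show "(\<lambda>x. f x * cnj (u i x)) \<in> borel_measurable M" "(\<lambda>x. s n x * cnj (u i x)) \<in> borel_measurable M" for n
        by measurable
      show "integrable M (\<lambda>x. 2 * cmod (f x))"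
        using Lp_imp_integrable[OF f] p by (auto intro: integrable_norm)
      show "AE x in M. (\<lambda>n. s n x * cnj (u i x)) \<longlonglongrightarrow> f x * cnj (u i x)"
        using lim by (intro AE_I2 tendsto_mult tendsto_const)
      show "AE x in M. norm (s n x * cnj (u i x)) \<le> 2 * cmod (f x)" for n
      proof (rule AE_I2)
        fix x assume "x \<in> space M"
        then show "norm (s n x * cnj (u i x)) \<le> 2 * cmod (f x)"
          using mult_mono[OF dom[of x n] u1[of x]] by (simp add: norm_mult)
      qed
    qed
    then have "(\<lambda>n. \<Sum>i\<in>F. cmod (L2_inner M (s n) (u i)) powr q) \<longlonglongrightarrow> (\<Sum>i\<in>F. cmod (L2_inner M f (u i)) powr q)"
      using q by (intro tendsto_sum tendsto_powr' tendsto_norm tendsto_const) auto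
    moreover have "(\<lambda>n. B * (\<integral>x. cmod (s n x) powr p \<partial>M) powr (q / p)) \<longlonglongrightarrow> B * (\<integral>x. cmod (f x) powr p \<partial>M) powr (q / p)"
      using p q by (intro tendsto_mult tendsto_powr' limp tendsto_const) auto
    ultimately have "(\<Sum>i\<in>F. cmod (L2_inner M f (u i)) powr q) \<le> B * (\<integral>x. cmod (f x) powr p \<partial>M) powr (q / p)"
      by (rule LIMSEQ_le) (use riesz_simple[OF u B F s p pq] in auto)
    then show ?thesis by (simp add: Lp_norm_def powr_powr)
  qed
  show ?thesis
  proof (rule nn_integral_count_space_leI[OF I])
    fix F assume "finite F" "F \<subseteq> I"
    then show "(\<Sum>i\<in>F. ennreal (cmod (L2_inner M f (u i)) powr q)) \<le> ennreal (B * Lp_norm M p f powr q)"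
      using fin by (simp add: sum_ennreal ennreal_leI)
  qed
qed

section \<open>Orthonormal exponentials and the Parseval identity\<close>

lemma fourier_eq_L2_inner: "fourier \<mu> f t = L2_inner \<mu> f (expo t)"
  unfolding fourier_def L2_inner_def expo_def by (simp add: exp_cnj exp_minus)

lemma norm_expo [simp]: "cmod (expo t x) = 1"
  by (simp add: expo_def norm_exp_eq_Re)

lemma expo_measurable: "expo t \<in> borel_measurable borel"
  unfolding expo_def by (intro borel_measurable_continuous_onI continuous_intros)

lemma expo_measurable_pair [measurable]: "(\<lambda>z. expo (fst z) (snd z)) \<in> borel_measurable (borel \<Otimes>\<^sub>M borel)"
  unfolding expo_def borel_prod by (intro borel_measurable_continuous_onI continuous_intros)

lemma Lp_2_iff: "f \<in> Lp \<mu> 2 \<longleftrightarrow> f \<in> borel_measurable \<mu> \<and> integrable \<mu> (\<lambda>x. (cmod (f x))\<^sup>2)"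
  unfolding Lp_def by (simp add: powr_numeral)

lemma Lp_norm_2_square: "(Lp_norm \<mu> 2 f)\<^sup>2 = (\<integral>x. (cmod (f x))\<^sup>2 \<partial>\<mu>)"
  unfolding Lp_norm_def by (simp add: powr_numeral powr_half_sqrt)

lemma Lp_norm_nonneg: "0 \<le> Lp_norm \<mu> p f"
  unfolding Lp_norm_def by simp

lemma norm_add_square_le: "(cmod (a + b))\<^sup>2 \<le> 2 * (cmod a)\<^sup>2 + 2 * (cmod b)\<^sup>2"
proof -
  have "(cmod (a + b))\<^sup>2 \<le> (cmod a + cmod b)\<^sup>2" by (intro power_mono norm_triangle_ineq) auto
  also have "\<dots> \<le> 2 * (cmod a)\<^sup>2 + 2 * (cmod b)\<^sup>2"
    using zero_le_power2[of "cmod a - cmod b"] by (simp add: power2_eq_square algebra_simps)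
  finally show ?thesis .
qed

lemma Lp_2_add: "f \<in> Lp \<mu> 2 \<Longrightarrow> g \<in> Lp \<mu> 2 \<Longrightarrow> (\<lambda>x. f x + g x) \<in> Lp \<mu> 2"
  unfolding Lp_2_iff
proof safe
  assume [measurable]: "f \<in> borel_measurable \<mu>" "g \<in> borel_measurable \<mu>"
    and i: "integrable \<mu> (\<lambda>x. (cmod (f x))\<^sup>2)" "integrable \<mu> (\<lambda>x. (cmod (g x))\<^sup>2)"
  show "(\<lambda>x. f x + g x) \<in> borel_measurable \<mu>" by measurable
  show "integrable \<mu> (\<lambda>x. (cmod (f x + g x))\<^sup>2)"
  proof (rule Bochner_Integration.integrable_bound)
    show "integrable \<mu> (\<lambda>x. 2 * (cmod (f x))\<^sup>2 + 2 * (cmod (g x))\<^sup>2)" using i by auto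
    show "AE x in \<mu>. norm ((cmod (f x + g x))\<^sup>2) \<le> norm (2 * (cmod (f x))\<^sup>2 + 2 * (cmod (g x))\<^sup>2)"
      by (intro AE_I2) (auto simp: norm_add_square_le)
  qed measurable
qed

lemma Lp_2_scale: "f \<in> Lp \<mu> 2 \<Longrightarrow> (\<lambda>x. c * f x) \<in> Lp \<mu> 2"
  by (auto simp: Lp_2_iff norm_mult power_mult_distrib)

locale borel_prob = prob_space M for M :: "'a::euclidean_space measure" +
  assumes sets_eq_borel [measurable_cong, simp]: "sets M = sets borel"

lemma (in borel_prob) expo_Lp: "expo t \<in> Lp M p"
  using expo_measurable[of t] measurable_cong_sets[of M borel borel borel] by (auto simp: Lp_def)

lemma (in borel_prob) integrable_mult_cnj_expo:
  assumes f: "f \<in> Lp M p" and p: "1 \<le> p"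
  shows "integrable M (\<lambda>x. f x * cnj (expo t x))"
proof (rule Bochner_Integration.integrable_bound)
  show "integrable M f" using f p by (rule Lp_imp_integrable)
  have [measurable]: "f \<in> borel_measurable M" using f by (simp add: Lp_def)
  have [measurable]: "expo t \<in> borel_measurable M" using expo_Lp by (simp add: Lp_def)
  show "(\<lambda>x. f x * cnj (expo t x)) \<in> borel_measurable M" by measurable
qed (simp add: norm_mult)

definition orthonormal_expo :: "'a::euclidean_space measure \<Rightarrow> 'a set \<Rightarrow> bool" where
  "orthonormal_expo \<mu> \<Lambda> \<longleftrightarrow> (\<forall>k\<in>\<Lambda>. \<forall>l\<in>\<Lambda>. L2_inner \<mu> (expo k) (expo l) = (if k = l then 1 else 0))"

text \<open>This identity contains both halves of Parseval's identity. With \<open>c\<^sub>l = \<langle>f, e\<^sub>l\<rangle>\<close> its left side is nonnegative,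
  which is the Bessel inequality; and if its left side is small for some \<open>c\<close>, then the Bessel sum is
  nearly the full norm. It follows by splitting off one exponential at a time.\<close>

lemma (in borel_prob) distance_to_span:
  fixes f :: "'a::euclidean_space \<Rightarrow> complex"
  assumes on: "orthonormal_expo M F" and F: "finite F" and f: "f \<in> Lp M 2"
  shows "(\<integral>x. (cmod (f x - (\<Sum>l\<in>F. c l * expo l x)))\<^sup>2 \<partial>M)
    = (\<integral>x. (cmod (f x))\<^sup>2 \<partial>M) - (\<Sum>l\<in>F. (cmod (L2_inner M f (expo l)))\<^sup>2)
      + (\<Sum>l\<in>F. (cmod (L2_inner M f (expo l) - c l))\<^sup>2)"
  using F on f
proof (induction F arbitrary: f)
  case (insert k F)
  define a where "a l = L2_inner M f (expo l)" for l
  define g where "g x = f x - c k * expo k x" for x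
  have g: "g \<in> Lp M 2"
    unfolding g_def using Lp_2_add[OF insert.prems(2) Lp_2_scale[OF expo_Lp, of "- c k" k]] by simp
  note int = integrable_mult_cnj_expo
  have inner_g: "L2_inner M g (expo l) = a l" if "l \<in> F" for l
  proof -
    have "L2_inner M g (expo l) = a l - c k * L2_inner M (expo k) (expo l)"
      unfolding g_def L2_inner_def a_def
      using int[OF insert.prems(2), of l] int[OF expo_Lp[of k 2], of l]
      by (simp add: left_diff_distrib mult.assoc)
    also have "L2_inner M (expo k) (expo l) = 0"
      using insert.prems(1) insert.hyps that by (auto simp: orthonormal_expo_def)
    finally show ?thesis by simp
  qed
  have norm_g: "(\<integral>x. (cmod (g x))\<^sup>2 \<partial>M) = (\<integral>x. (cmod (f x))\<^sup>2 \<partial>M) - (cmod (a k))\<^sup>2 + (cmod (a k - c k))\<^sup>2"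
  proof -
    have expand: "(cmod (u - v))\<^sup>2 = (cmod u)\<^sup>2 - 2 * Re (u * cnj v) + (cmod v)\<^sup>2" for u v
      unfolding cmod_power2 by (simp add: power2_eq_square algebra_simps)
    define h where "h x = cnj (c k) * (f x * cnj (expo k x))" for x
    have h: "integrable M h" "integral\<^sup>L M h = cnj (c k) * a k"
      unfolding h_def a_def L2_inner_def using int[OF insert.prems(2), of k] by auto
    have "(cmod (g x))\<^sup>2 = (cmod (f x))\<^sup>2 - 2 * Re (h x) + (cmod (c k))\<^sup>2" for x
      unfolding g_def h_def expand by (simp add: norm_mult algebra_simps)
    then have "(\<integral>x. (cmod (g x))\<^sup>2 \<partial>M) = (\<integral>x. (cmod (f x))\<^sup>2 \<partial>M) - 2 * Re (cnj (c k) * a k) + (cmod (c k))\<^sup>2"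
      using h insert.prems(2) by (simp add: Lp_2_iff prob_space del: integral_Re) (simp add: integral_Re)
    also have "\<dots> = (\<integral>x. (cmod (f x))\<^sup>2 \<partial>M) - (cmod (a k))\<^sup>2 + (cmod (a k - c k))\<^sup>2"
      unfolding expand by (simp add: mult.commute)
    finally show ?thesis .
  qed
  have "(\<integral>x. (cmod (f x - (\<Sum>l\<in>insert k F. c l * expo l x)))\<^sup>2 \<partial>M)
      = (\<integral>x. (cmod (g x - (\<Sum>l\<in>F. c l * expo l x)))\<^sup>2 \<partial>M)"
    using insert.hyps by (simp add: g_def algebra_simps)
  also have "\<dots> = (\<integral>x. (cmod (g x))\<^sup>2 \<partial>M) - (\<Sum>l\<in>F. (cmod (a l))\<^sup>2) + (\<Sum>l\<in>F. (cmod (a l - c l))\<^sup>2)"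
    using insert.IH[OF _ g] insert.prems(1) by (simp add: inner_g orthonormal_expo_def)
  finally show ?case using insert.hyps norm_g by (simp add: a_def)
qed simp

lemma (in borel_prob) bessel_inequality:
  fixes f :: "'a::euclidean_space \<Rightarrow> complex"
  assumes on: "orthonormal_expo M F" and F: "finite F" and f: "f \<in> Lp M 2"
  shows "(\<Sum>l\<in>F. (cmod (L2_inner M f (expo l)))\<^sup>2) \<le> (\<integral>x. (cmod (f x))\<^sup>2 \<partial>M)"
proof -
  have "0 \<le> (\<integral>x. (cmod (f x - (\<Sum>l\<in>F. L2_inner M f (expo l) * expo l x)))\<^sup>2 \<partial>M)" by simp
  then show ?thesis unfolding distance_to_span[OF assms] by simp
qed

lemma is_spectrum_orthonormal: "is_spectrum \<mu> \<Lambda> \<Longrightarrow> F \<subseteq> \<Lambda> \<Longrightarrow> orthonormal_expo \<mu> F"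
  unfolding is_spectrum_def orthonormal_expo_def by (simp add: subset_iff)

text \<open>The upper bound is the Bessel inequality; density of the linear combinations of exponentials
  provides coefficients for which the distance is arbitrarily small, hence the lower bound.\<close>

proposition (in borel_prob) parseval:
  fixes f :: "'a::euclidean_space \<Rightarrow> complex"
  assumes sp: "is_spectrum M \<Lambda>" and f: "f \<in> Lp M 2"
  shows "(\<integral>\<^sup>+l. ennreal ((cmod (L2_inner M f (expo l)))\<^sup>2) \<partial>count_space \<Lambda>) = ennreal (\<integral>x. (cmod (f x))\<^sup>2 \<partial>M)"
    (is "?S = ennreal ?n")
proof (rule antisym)
  have c: "countable \<Lambda>" using sp by (simp add: is_spectrum_def)
  show "?S \<le> ennreal ?n"
  proof (rule nn_integral_count_space_leI[OF c])
    fix F assume F: "finite F" "F \<subseteq> \<Lambda>"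
    then show "(\<Sum>l\<in>F. ennreal ((cmod (L2_inner M f (expo l)))\<^sup>2)) \<le> ennreal ?n"
      using bessel_inequality[OF is_spectrum_orthonormal[OF sp F(2)] F(1) f]
      by (simp add: sum_ennreal ennreal_leI)
  qed
  show "ennreal ?n \<le> ?S"
  proof (rule ennreal_le_epsilon)
    fix e :: real assume e: "0 < e"
    then obtain F c where F: "finite F" "F \<subseteq> \<Lambda>"
      and less: "Lp_norm M 2 (\<lambda>x. f x - (\<Sum>l\<in>F. c l * expo l x)) < sqrt e"
      using sp f unfolding is_spectrum_def by (metis real_sqrt_gt_zero)
    have "(Lp_norm M 2 (\<lambda>x. f x - (\<Sum>l\<in>F. c l * expo l x)))\<^sup>2 < (sqrt e)\<^sup>2"
      using less by (intro power_strict_mono Lp_norm_nonneg) auto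
    then have "?n - (\<Sum>l\<in>F. (cmod (L2_inner M f (expo l)))\<^sup>2) + (\<Sum>l\<in>F. (cmod (L2_inner M f (expo l) - c l))\<^sup>2) < e"
      unfolding Lp_norm_2_square distance_to_span[OF is_spectrum_orthonormal[OF sp F(2)] F(1) f]
      using e by simp
    moreover have "0 \<le> (\<Sum>l\<in>F. (cmod (L2_inner M f (expo l) - c l))\<^sup>2)" by (simp add: sum_nonneg)
    ultimately have "?n \<le> (\<Sum>l\<in>F. (cmod (L2_inner M f (expo l)))\<^sup>2) + e" by simp
    then have "ennreal ?n \<le> ennreal (\<Sum>l\<in>F. (cmod (L2_inner M f (expo l)))\<^sup>2) + ennreal e"
      using e by (subst ennreal_plus[symmetric]) (auto intro: ennreal_leI sum_nonneg)
    also have "ennreal (\<Sum>l\<in>F. (cmod (L2_inner M f (expo l)))\<^sup>2) \<le> ?S"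
      using sum_le_nn_integral_count_space[OF F(2,1), of "\<lambda>l. ennreal ((cmod (L2_inner M f (expo l)))\<^sup>2)"]
      by (simp add: sum_ennreal)
    finally show "ennreal ?n \<le> ?S + ennreal e" by (simp add: add_right_mono)
  qed
qed

proposition (in borel_prob) spectrum_bessel_family:
  fixes \<Lambda> :: "'a::euclidean_space set"
  assumes sp: "is_spectrum M \<Lambda>"
  shows "bessel_family M \<Lambda> expo 1"
  unfolding bessel_family_def
  using bessel_inequality[OF is_spectrum_orthonormal[OF sp]] expo_Lp[of _ 2] by (auto simp: Lp_def)

lemma (in borel_prob) F_spectrum_bessel_family:
  assumes sp: "is_F_spectrum M \<Lambda>"
  obtains B where "0 < B" "bessel_family M \<Lambda> expo B"
proof -
  obtain B where B: "B > 0" "\<And>f. f \<in> Lp M 2 \<Longrightarrow>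
     (\<integral>\<^sup>+l. ennreal ((cmod (L2_inner M f (expo l)))\<^sup>2) \<partial>count_space \<Lambda>) \<le> ennreal (B * (Lp_norm M 2 f)\<^sup>2)"
    using sp unfolding is_F_spectrum_def by blast
  have "(\<Sum>l\<in>F. (cmod (L2_inner M f (expo l)))\<^sup>2) \<le> B * (\<integral>x. (cmod (f x))\<^sup>2 \<partial>M)"
    if "finite F" "F \<subseteq> \<Lambda>" "f \<in> Lp M 2" for F f
  proof -
    have "ennreal (\<Sum>l\<in>F. (cmod (L2_inner M f (expo l)))\<^sup>2) \<le> ennreal (B * (Lp_norm M 2 f)\<^sup>2)"
      using order_trans[OF sum_le_nn_integral_count_space[OF that(2,1), of "\<lambda>l. ennreal ((cmod (L2_inner M f (expo l)))\<^sup>2)"] B(2)[OF that(3)]]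
      by (simp add: sum_ennreal)
    then show ?thesis using B(1) by (simp add: ennreal_le_iff Lp_norm_2_square)
  qed
  then have "bessel_family M \<Lambda> expo B"
    unfolding bessel_family_def using expo_Lp[of _ 2] by (auto simp: Lp_def)
  with B(1) show thesis by (rule that)
qed

section \<open>Bessel measures and Bessel families of exponentials\<close>

text \<open>As an image measure, a sum of Dirac measures integrates measurable functions by
  summation over its point set.\<close>

lemma dirac_sum_eq_distr:
  fixes \<Lambda> :: "'a::topological_space set"
  shows "dirac_sum \<Lambda> = distr (count_space \<Lambda>) borel (\<lambda>l. l)"
proof (rule measure_eqI)
  fix A assume "A \<in> sets (dirac_sum \<Lambda>)"
  then have A: "A \<in> sets borel" by simp
  have "emeasure (dirac_sum \<Lambda>) A = (\<integral>\<^sup>+l. indicator A l \<partial>count_space \<Lambda>)"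
    using A by (simp add: emeasure_dirac_sum)
  also have "\<dots> = (\<integral>\<^sup>+l. indicator A l \<partial>distr (count_space \<Lambda>) borel (\<lambda>l. l))"
    using A by (subst nn_integral_distr) auto
  also have "\<dots> = emeasure (distr (count_space \<Lambda>) borel (\<lambda>l. l)) A"
    using A by simp
  finally show "emeasure (dirac_sum \<Lambda>) A = emeasure (distr (count_space \<Lambda>) borel (\<lambda>l. l)) A" .
qed simp

lemma emeasure_dirac_sum_UNIV:
  fixes \<Lambda> :: "'a::topological_space set"
  shows "infinite \<Lambda> \<Longrightarrow> emeasure (dirac_sum \<Lambda>) UNIV = \<infinity>"
  by (simp add: dirac_sum_eq_distr emeasure_distr emeasure_count_space)

text \<open>Needed for both kinds of exponents: an essential supremum is \<open>\<infinity>\<close> by convention for a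
  function that is not measurable, and the change of variables for \<open>dirac_sum\<close> requires measurability.\<close>

lemma (in borel_prob) fourier_measurable:
  fixes f :: "'a::euclidean_space \<Rightarrow> complex"
  assumes f: "f \<in> borel_measurable M"
  shows "fourier M f \<in> borel_measurable borel"
  unfolding fourier_eq_L2_inner[abs_def] L2_inner_def
proof (rule borel_measurable_lebesgue_integral)
  note [measurable] = f
  show "(\<lambda>(t, x). f x * cnj (expo t x)) \<in> borel_measurable (borel \<Otimes>\<^sub>M M)"
    by (simp add: split_beta') measurable
qed

text \<open>The modulus of an exponential is one, so its norm and the power of its modulus drop out and its
  sign is the exponential itself.\<close>

lemma (in borel_prob) semi_inner_expo: "0 < p \<Longrightarrow> semi_inner M p f (expo t) = L2_inner M f (expo t)"
  by (simp add: semi_inner_def L2_inner_def Lp_norm_def prob_space sgn_div_norm)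

lemma conjugate_exponent_cases:
  assumes "1 \<le> p" "1 / ennreal p + 1 / q = 1"
  obtains "p = 1" "q = \<infinity>" | r where "1 < p" "0 < r" "q = ennreal r" "1 / p + 1 / r = 1"
proof -
  have p: "1 / ennreal p = ennreal (1 / p)"
    using assms by (simp add: divide_ennreal flip: ennreal_1)
  show thesis
  proof (cases q)
    case (real r)
    have r: "r \<noteq> 0" using assms(2) real by (intro notI) (simp add: ennreal_divide_zero)
    then have "1 / q = ennreal (1 / r)" using real by (simp add: divide_ennreal flip: ennreal_1)
    then have "ennreal (1 / p + 1 / r) = ennreal 1"
      using assms p real by (subst ennreal_plus) auto
    then have *: "1 / p + 1 / r = 1" using assms real by (subst (asm) ennreal_inj) auto
    moreover have "1 < p" using * r real assms by (cases "p = 1") auto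
    ultimately show ?thesis using that(2)[of r] r real by auto
  next
    case top
    then have "ennreal (1 / p) = ennreal 1" using assms p by simp
    then show ?thesis using assms that(1) top by (subst (asm) ennreal_inj) auto
  qed
qed

proposition (in borel_prob) hausdorff_young_q_bessel:
  fixes \<Lambda> :: "'a::euclidean_space set"
  assumes \<Lambda>: "countable \<Lambda>" and B: "0 < B" "bessel_family M \<Lambda> expo B"
    and p: "1 < p" "p \<le> 2" "1 / p + 1 / q = 1"
  shows "is_q_bessel M p q \<Lambda> expo B"
  unfolding is_q_bessel_def
  using riesz_hausdorff_young[OF \<Lambda> B(2,1) _ p] p B expo_Lp by (auto simp: semi_inner_expo)

text \<open>The hypothesis \<open>1 \<le> B\<close> lets the same constant cover \<open>p = 1\<close>, where the optimal bound is one.\<close>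

proposition (in borel_prob) hausdorff_young_bessel_measure:
  fixes \<Lambda> :: "'a::euclidean_space set"
  assumes \<Lambda>: "countable \<Lambda>" and B: "1 \<le> B" "bessel_family M \<Lambda> expo B"
    and p: "1 \<le> p" "p \<le> 2" "1 / ennreal p + 1 / q = 1"
  shows "dirac_sum \<Lambda> \<in> bessel_measures M p q B"
  using p(1,3)
proof (cases rule: conjugate_exponent_cases)
  case 1
  have "esssup (dirac_sum \<Lambda>) (\<lambda>t. ennreal (cmod (fourier M f t))) \<le> ennreal (B * Lp_norm M 1 f)"
    if f: "f \<in> Lp M 1" for f
  proof (rule esssup_I)
    have [measurable]: "fourier M f \<in> borel_measurable borel"
      using f by (intro fourier_measurable) (simp add: Lp_def)
    show "(\<lambda>t. ennreal (cmod (fourier M f t))) \<in> borel_measurable (dirac_sum \<Lambda>)" by measurable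
    show "AE t in dirac_sum \<Lambda>. ennreal (cmod (fourier M f t)) \<le> ennreal (B * Lp_norm M 1 f)"
    proof (intro AE_I2 ennreal_leI)
      fix t
      have "cmod (fourier M f t) \<le> (\<integral>x. cmod (f x * cnj (expo t x)) \<partial>M)"
        unfolding fourier_eq_L2_inner L2_inner_def by (rule integral_norm_bound)
      also have "\<dots> = 1 * Lp_norm M 1 f" by (simp add: norm_mult Lp_norm_def)
      also have "\<dots> \<le> B * Lp_norm M 1 f" using B by (intro mult_right_mono Lp_norm_nonneg) auto
      finally show "cmod (fourier M f t) \<le> B * Lp_norm M 1 f" .
    qed
  qed
  then show ?thesis using 1 B by (simp add: bessel_measures_def)
next
  case (2 r)
  have "(\<integral>\<^sup>+t. ennreal (cmod (semi_inner M p f (expo t)) powr r) \<partial>dirac_sum \<Lambda>) \<le> ennreal (B * Lp_norm M p f powr r)"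
    if f: "f \<in> Lp M p" for f
  proof -
    have [measurable]: "fourier M f \<in> borel_measurable borel"
      using f by (intro fourier_measurable) (simp add: Lp_def)
    have "(\<integral>\<^sup>+t. ennreal (cmod (semi_inner M p f (expo t)) powr r) \<partial>dirac_sum \<Lambda>)
        = (\<integral>\<^sup>+t. ennreal (cmod (fourier M f t) powr r) \<partial>count_space \<Lambda>)"
      using 2 by (simp add: semi_inner_expo fourier_eq_L2_inner[symmetric] dirac_sum_eq_distr nn_integral_distr)
    also have "\<dots> \<le> ennreal (B * Lp_norm M p f powr r)"
      unfolding fourier_eq_L2_inner using B p 2 by (intro riesz_hausdorff_young \<Lambda> f) auto
    finally show ?thesis .
  qed
  then show ?thesis using 2 B by (simp add: bessel_measures_def)
qed

section \<open>Trigonometric polynomials\<close>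

lemma expo_add: "expo (s + t) x = expo s x * expo t x"
  by (simp add: expo_def inner_add_left distrib_left flip: exp_add)

lemma expo_0 [simp]: "expo 0 x = 1"
  by (simp add: expo_def)

lemma cnj_expo: "cnj (expo t x) = expo (- t) x"
  by (simp add: expo_def exp_cnj)

text \<open>The inductive form makes closure under products immediate; the representation as a sum over a
  finite set of distinct frequencies is recovered in \<open>trig_poly_imp_sum\<close>.\<close>

inductive trig_poly :: "'a::euclidean_space set \<Rightarrow> ('a \<Rightarrow> complex) \<Rightarrow> bool" for \<Lambda> where
  expo: "l \<in> \<Lambda> \<Longrightarrow> trig_poly \<Lambda> (\<lambda>x. c * expo l x)"
| add: "trig_poly \<Lambda> f \<Longrightarrow> trig_poly \<Lambda> g \<Longrightarrow> trig_poly \<Lambda> (\<lambda>x. f x + g x)"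

lemma trig_poly_sum:
  assumes "\<Lambda> \<noteq> {}" "\<And>i. i \<in> I \<Longrightarrow> trig_poly \<Lambda> (f i)"
  shows "trig_poly \<Lambda> (\<lambda>x. \<Sum>i\<in>I. f i x)"
proof (cases "finite I")
  have zero: "trig_poly \<Lambda> (\<lambda>x. 0)"
    using assms(1) trig_poly.expo[of _ \<Lambda> 0] by auto
  {
    case True
    then show ?thesis using assms(2)
      by (induction I) (auto intro: trig_poly.add zero)
  next
    case False
    then show ?thesis using zero by simp
  }
qed

lemma trig_poly_mult:
  assumes closed: "\<And>k l. k \<in> \<Lambda> \<Longrightarrow> l \<in> \<Lambda> \<Longrightarrow> k + l \<in> \<Lambda>" and f: "trig_poly \<Lambda> f" and g: "trig_poly \<Lambda> g"
  shows "trig_poly \<Lambda> (\<lambda>x. f x * g x)"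
  using f
proof induction
  case (expo k c)
  show ?case using g
  proof induction
    case (expo l d)
    have "(\<lambda>x. c * expo k x * (d * expo l x)) = (\<lambda>x. (c * d) * expo (k + l) x)"
      by (simp add: expo_add fun_eq_iff)
    then show ?case using trig_poly.expo[of "k + l" \<Lambda> "c * d"] closed expo \<open>k \<in> \<Lambda>\<close> by simp
  next
    case (add f1 f2)
    then show ?case by (simp add: distrib_left trig_poly.add)
  qed
next
  case (add f1 f2)
  then show ?case by (simp add: distrib_right trig_poly.add)
qed

lemma trig_poly_imp_sum:
  "trig_poly \<Lambda> f \<Longrightarrow> \<exists>F c. finite F \<and> F \<subseteq> \<Lambda> \<and> f = (\<lambda>x. \<Sum>l\<in>F. c l * expo l x)"
proof (induction rule: trig_poly.induct)
  case (expo l c)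
  then show ?case by (intro exI[of _ "{l}"] exI[of _ "\<lambda>_. c"]) auto
next
  case (add f g)
  then obtain F c G d where *: "finite F" "F \<subseteq> \<Lambda>" "f = (\<lambda>x. \<Sum>l\<in>F. c l * expo l x)"
    "finite G" "G \<subseteq> \<Lambda>" "g = (\<lambda>x. \<Sum>l\<in>G. d l * expo l x)" by auto
  define e where "e l = (if l \<in> F then c l else 0) + (if l \<in> G then d l else 0)" for l
  have "(\<Sum>l\<in>F \<union> G. e l * expo l x) = f x + g x" for x
  proof -
    have "(\<Sum>l\<in>F \<union> G. e l * expo l x) = (\<Sum>l\<in>F \<union> G. (if l \<in> F then c l * expo l x else 0))
      + (\<Sum>l\<in>F \<union> G. (if l \<in> G then d l * expo l x else 0))"
      unfolding sum.distrib[symmetric] by (intro sum.cong) (auto simp: e_def distrib_right)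
    also have "\<dots> = f x + g x"
      using * by (simp add: sum.inter_restrict[symmetric] Int_absorb1)
    finally show ?thesis .
  qed
  then show ?case using * by (intro exI[of _ "F \<union> G"] exI[of _ e]) auto
qed

lemma (in borel_prob) trig_poly_Lp_2: "trig_poly \<Lambda> f \<Longrightarrow> f \<in> Lp M 2"
  by (induction rule: trig_poly.induct) (auto intro: Lp_2_add Lp_2_scale expo_Lp)

section \<open>The lattice of a cube\<close>

definition open_cube :: "real \<Rightarrow> 'a::euclidean_space set" where
  "open_cube R = box (- R *\<^sub>R One) (R *\<^sub>R One)"

definition cube_prob :: "real \<Rightarrow> 'a::euclidean_space measure" where
  "cube_prob R = density lborel (\<lambda>x::'a. ennreal (indicator (open_cube R) x / (2 * R) ^ DIM('a)))"

definition cube_lattice :: "real \<Rightarrow> 'a::euclidean_space set" where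
  "cube_lattice R = {t. \<forall>b\<in>Basis. \<exists>n::int. t \<bullet> b = of_int n / (2 * R)}"

lemma mem_open_cube: "x \<in> open_cube R \<longleftrightarrow> (\<forall>b\<in>Basis. \<bar>x \<bullet> b\<bar> < R)"
  by (auto simp: open_cube_def mem_box abs_less_iff algebra_simps)

lemma open_open_cube [simp]: "open (open_cube R)"
  by (simp add: open_cube_def open_box)

lemma borel_open_cube [measurable]: "open_cube R \<in> sets borel"
  by (simp add: open_cube_def)

lemma emeasure_open_cube:
  assumes "0 < R"
  shows "emeasure lborel (open_cube R :: 'a::euclidean_space set) = ennreal ((2 * R) ^ DIM('a))"
proof -
  have "emeasure lborel (open_cube R :: 'a set) = ennreal (\<Prod>b\<in>Basis. (R *\<^sub>R One - (- R *\<^sub>R One)) \<bullet> (b :: 'a))"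
    unfolding open_cube_def using assms by (intro emeasure_lborel_box) simp
  also have "(\<Prod>b\<in>Basis. (R *\<^sub>R One - (- R *\<^sub>R One)) \<bullet> (b :: 'a)) = (\<Prod>b\<in>(Basis :: 'a set). 2 * R)"
    by (intro prod.cong) (auto simp: inner_add_left)
  finally show ?thesis by simp
qed

lemma borel_prob_cube_prob:
  assumes R: "0 < R"
  shows "borel_prob (cube_prob R :: 'a::euclidean_space measure)"
proof -
  have "emeasure (cube_prob R :: 'a measure) UNIV
      = (\<integral>\<^sup>+x. ennreal (1 / (2 * R) ^ DIM('a)) * indicator (open_cube R) (x::'a) \<partial>lborel)"
    unfolding cube_prob_def
    by (subst emeasure_density) (auto intro!: nn_integral_cong split: split_indicator)
  also have "\<dots> = 1"
    using R by (simp add: nn_integral_cmult_indicator emeasure_open_cube flip: ennreal_mult)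
  finally show ?thesis
    by (intro borel_prob.intro prob_spaceI borel_prob_axioms.intro) (auto simp: cube_prob_def)
qed

lemma countable_cube_lattice: "countable (cube_lattice R :: 'a::euclidean_space set)"
proof (rule countable_subset)
  show "cube_lattice R \<subseteq> (\<lambda>n. \<Sum>b\<in>Basis. (of_int (n b) / (2 * R)) *\<^sub>R b) ` (Pi\<^sub>E (Basis::'a set) (\<lambda>_. UNIV :: int set))"
  proof
    fix t :: 'a assume "t \<in> cube_lattice R"
    then obtain n :: "'a \<Rightarrow> int" where n: "\<And>b. b \<in> Basis \<Longrightarrow> t \<bullet> b = of_int (n b) / (2 * R)"
      unfolding cube_lattice_def by (simp add: Bex_def) metis
    have "t = (\<Sum>b\<in>Basis. (t \<bullet> b) *\<^sub>R b)" by (simp add: euclidean_representation)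
    also have "\<dots> = (\<Sum>b\<in>Basis. (of_int (restrict n Basis b) / (2 * R)) *\<^sub>R b)"
      by (intro sum.cong) (auto simp: n)
    finally show "t \<in> (\<lambda>n. \<Sum>b\<in>Basis. (of_int (n b) / (2 * R)) *\<^sub>R b) ` (Pi\<^sub>E (Basis::'a set) (\<lambda>_. UNIV :: int set))"
      by (intro image_eqI[of _ _ "restrict n Basis"]) auto
  qed
  show "countable ((\<lambda>n. \<Sum>b\<in>Basis. (of_int (n b) / (2 * R)) *\<^sub>R b) ` (Pi\<^sub>E (Basis::'a set) (\<lambda>_. UNIV :: int set)))"
    by (intro countable_image countable_PiE) auto
qed

lemma cube_lattice_0: "0 \<in> cube_lattice R"
  by (auto simp: cube_lattice_def intro: exI[of _ 0])

lemma cube_lattice_add: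
  assumes "s \<in> cube_lattice R" "t \<in> cube_lattice R" shows "s + t \<in> cube_lattice R"
  unfolding cube_lattice_def
proof safe
  fix b :: 'a assume "b \<in> Basis"
  then obtain m n :: int where "s \<bullet> b = of_int m / (2 * R)" "t \<bullet> b = of_int n / (2 * R)"
    using assms unfolding cube_lattice_def by blast
  then show "\<exists>k::int. (s + t) \<bullet> b = of_int k / (2 * R)"
    by (intro exI[of _ "m + n"]) (simp add: inner_add_left add_divide_distrib)
qed

lemma cube_lattice_minus:
  assumes "t \<in> cube_lattice R" shows "- t \<in> cube_lattice R"
  unfolding cube_lattice_def
proof safe
  fix b :: 'a assume "b \<in> Basis"
  then obtain n :: int where "t \<bullet> b = of_int n / (2 * R)"
    using assms by (auto simp: cube_lattice_def)
  then show "\<exists>k::int. (- t) \<bullet> b = of_int k / (2 * R)"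
    by (intro exI[of _ "- n"]) simp
qed

text \<open>The values of the antiderivative at the two ends of the interval agree, since they are a full number
  of periods apart.\<close>

lemma integral_exp_period:
  fixes n :: int
  assumes R: "0 < R" and n: "n \<noteq> 0"
  shows "(\<integral>y. indicator {-R<..<R} y *\<^sub>R exp (2 * of_real pi * \<i> * of_real (of_int n / (2 * R) * y)) \<partial>lborel) = 0"
proof -
  define w where "w = 2 * of_real pi * \<i> * of_real (of_int n / (2 * R))"
  have w0: "w \<noteq> 0" using R n by (simp add: w_def)
  have e: "exp (2 * of_real pi * \<i> * of_real (of_int n / (2 * R) * y)) = exp (w * of_real y)" for y
    by (simp add: w_def mult.assoc)
  have "(\<integral>y. indicator {-R<..<R} y *\<^sub>R exp (w * of_real y) \<partial>lborel)
      = (\<integral>y. indicator {-R..R} y *\<^sub>R exp (w * of_real y) \<partial>lborel)"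
  proof (rule integral_cong_AE)
    show "AE y in lborel. indicator {-R<..<R} y *\<^sub>R exp (w * of_real y) = indicator {-R..R} y *\<^sub>R exp (w * of_real y)"
      using AE_lborel_singleton[of R] AE_lborel_singleton[of "-R"]
      by eventually_elim (auto split: split_indicator)
  qed measurable
  also have "\<dots> = exp (w * of_real R) / w - exp (w * of_real (- R)) / w"
  proof (rule integral_FTC_atLeastAtMost)
    show "- R \<le> R" using R by simp
    show "continuous_on {- R..R} (\<lambda>y. exp (w * of_real y))" by (intro continuous_intros)
    fix x
    have "((\<lambda>z. exp (w * z) / w) has_field_derivative exp (w * of_real x)) (at (of_real x))"
      using w0 by (auto intro!: derivative_eq_intros)
    then show "((\<lambda>y. exp (w * of_real y) / w) has_vector_derivative exp (w * of_real x)) (at x within {- R..R})"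
      by (rule has_vector_derivative_real_field)
  qed
  also have "exp (w * of_real R) = exp (w * of_real (- R))"
  proof -
    have "w * of_real R = w * of_real (- R) + of_int (2 * n) * (of_real pi * \<i>)"
      using R by (simp add: w_def field_simps)
    then show ?thesis
      unfolding exp_eq by (intro exI[of _ n]) simp
  qed
  finally show ?thesis unfolding e by simp
qed

text \<open>An exponential is a product of functions of one coordinate, so Fubini's theorem applies; a
  coordinate in which \<open>t\<close> does not vanish contributes a factor zero.\<close>

lemma integral_expo_cube:
  assumes R: "0 < R" and t: "t \<in> cube_lattice R" "t \<noteq> 0"
  shows "(\<integral>x. expo t x \<partial>(cube_prob R :: 'a::euclidean_space measure)) = 0"
proof -
  define h where "h b y = indicator {-R<..<R} y *\<^sub>R exp (2 * of_real pi * \<i> * of_real ((t \<bullet> b) * y))" for b and y :: real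
  have prod: "indicator (open_cube R) x *\<^sub>R expo t x = (\<Prod>b\<in>Basis. h b (x \<bullet> b))" for x
  proof (cases "x \<in> open_cube R")
    case True
    have "expo t x = exp (\<Sum>b\<in>Basis. 2 * of_real pi * \<i> * of_real ((t \<bullet> b) * (x \<bullet> b)))"
      by (simp add: expo_def euclidean_inner[of t x] sum_distrib_left)
    also have "\<dots> = (\<Prod>b\<in>Basis. exp (2 * of_real pi * \<i> * of_real ((t \<bullet> b) * (x \<bullet> b))))"
      by (simp add: exp_sum)
    also have "\<dots> = (\<Prod>b\<in>Basis. h b (x \<bullet> b))"
      using True by (intro prod.cong) (auto simp: h_def mem_open_cube abs_less_iff minus_less_iff)
    finally show ?thesis using True by simp
  next
    case False
    then obtain b where b: "b \<in> Basis" "\<not> \<bar>x \<bullet> b\<bar> < R"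
      by (auto simp: mem_open_cube)
    then have "h b (x \<bullet> b) = 0"
      by (auto simp: h_def indicator_def)
    then have "(\<Prod>b\<in>Basis. h b (x \<bullet> b)) = 0" using b by (auto simp: prod_zero_iff)
    then show ?thesis using False by simp
  qed
  have [measurable]: "h b \<in> borel_measurable borel" for b
  proof -
    have [measurable]: "(\<lambda>y. exp (2 * of_real pi * \<i> * of_real ((t \<bullet> b) * y))) \<in> borel_measurable borel"
      by (intro borel_measurable_continuous_onI continuous_intros)
    show ?thesis unfolding h_def by measurable
  qed
  have inth: "integrable lborel (h b)" for b
  proof (rule Bochner_Integration.integrable_bound)
    show "integrable lborel (indicator {-R<..<R} :: real \<Rightarrow> real)"
      using R by (intro integrable_real_indicator) auto
    show "AE x in lborel. norm (h b x) \<le> norm (indicator {-R<..<R} x :: real)"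
      by (auto simp: h_def norm_exp_eq_Re)
  qed simp
  interpret product_sigma_finite "\<lambda>_::'a. lborel :: real measure" ..
  obtain b where b: "b \<in> Basis" "t \<bullet> b \<noteq> 0" using t(2) by (metis euclidean_all_zero_iff)
  then obtain n :: int where n: "t \<bullet> b = of_int n / (2 * R)" using t(1) by (auto simp: cube_lattice_def)
  have "integral\<^sup>L lborel (h b) = 0"
    unfolding h_def n using b n R by (intro integral_exp_period) auto
  then have "(\<Prod>b\<in>Basis. integral\<^sup>L lborel (h b)) = 0" using b by (auto simp: prod_zero_iff)
  also have "(\<Prod>b\<in>Basis. integral\<^sup>L lborel (h b)) = (\<integral>x. (\<Prod>b\<in>Basis. h b (x b)) \<partial>(\<Pi>\<^sub>M b\<in>Basis. lborel))"
    by (intro product_integral_prod[symmetric] inth) auto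
  also have "\<dots> = (\<integral>x. (\<Prod>b\<in>Basis. h b (x \<bullet> b)) \<partial>(lborel :: 'a measure))"
    by (subst lborel_eq, subst integral_distr) (auto intro!: Bochner_Integration.integral_cong prod.cong)
  finally have 0: "(\<integral>x. indicator (open_cube R) x *\<^sub>R expo t x \<partial>lborel) = 0"
    by (simp add: prod)
  have "(\<integral>x. expo t x \<partial>(cube_prob R :: 'a measure)) = (\<integral>x. (indicator (open_cube R) x / (2 * R) ^ DIM('a)) *\<^sub>R expo t x \<partial>lborel)"
    unfolding cube_prob_def using R expo_measurable[of t] by (subst integral_density) auto
  also have "\<dots> = (\<integral>x. (1 / (2 * R) ^ DIM('a)) *\<^sub>R (indicator (open_cube R) x *\<^sub>R expo t x) \<partial>lborel)"
    by simp
  also have "\<dots> = 0" unfolding integral_scaleR_right 0 by simp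
  finally show ?thesis .
qed

lemma cube_lattice_orthonormal:
  assumes R: "0 < R"
  shows "orthonormal_expo (cube_prob R :: 'a::euclidean_space measure) (cube_lattice R)"
  unfolding orthonormal_expo_def
proof (intro ballI)
  fix k l :: 'a assume kl: "k \<in> cube_lattice R" "l \<in> cube_lattice R"
  interpret borel_prob "cube_prob R :: 'a measure" using R by (rule borel_prob_cube_prob)
  have "L2_inner (cube_prob R) (expo k) (expo l) = (\<integral>x. expo (k - l) x \<partial>cube_prob R)"
    unfolding L2_inner_def cnj_expo expo_add[symmetric] by simp
  also have "\<dots> = (if k = l then 1 else 0)"
  proof (cases "k = l")
    case True
    then show ?thesis using prob_space by simp
  next
    case False
    have "k - l \<in> cube_lattice R" using cube_lattice_add[OF kl(1) cube_lattice_minus[OF kl(2)]] by simp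
    then show ?thesis using integral_expo_cube[OF R, of "k - l"] False by simp
  qed
  finally show "L2_inner (cube_prob R) (expo k) (expo l) = (if k = l then 1 else 0)" .
qed

section \<open>Uniform approximation by trigonometric polynomials\<close>

text \<open>The quotient map from the cube to the torus, embedded in \<open>'a \<times> 'a\<close> so that the Stone--Weierstrass
  theorem for polynomials in a Euclidean space can be used there. It identifies opposite faces of the closed
  cube and is injective on the open cube.\<close>

definition torus_map :: "real \<Rightarrow> 'a::euclidean_space \<Rightarrow> 'a \<times> 'a" where
  "torus_map R x = (\<Sum>b\<in>Basis. cos (pi * (x \<bullet> b) / R) *\<^sub>R b, \<Sum>b\<in>Basis. sin (pi * (x \<bullet> b) / R) *\<^sub>R b)"

lemma continuous_torus_map: "continuous_on S (torus_map R)"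
  unfolding torus_map_def divide_inverse by (intro continuous_intros)

lemma torus_map_eq_imp:
  assumes R: "0 < R" and eq: "torus_map R x = torus_map R y" and x: "x \<in> open_cube R"
    and y: "y \<in> cbox (- R *\<^sub>R One) (R *\<^sub>R One)"
  shows "x = y"
proof (rule euclidean_eqI)
  fix b :: 'a assume b: "b \<in> Basis"
  have coord: "fst (torus_map R z) \<bullet> b = cos (pi * (z \<bullet> b) / R)" "snd (torus_map R z) \<bullet> b = sin (pi * (z \<bullet> b) / R)" for z
    using b by (simp_all add: torus_map_def inner_sum_left inner_Basis if_distrib cong: if_cong)
  have "sin (pi * (x \<bullet> b) / R) = sin (pi * (y \<bullet> b) / R) \<and> cos (pi * (x \<bullet> b) / R) = cos (pi * (y \<bullet> b) / R)"
    using eq coord by metis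
  then obtain n :: int where "pi * (x \<bullet> b) / R = pi * (y \<bullet> b) / R + 2 * pi * of_int n"
    using sin_cos_eq_iff by blast
  then have "pi * (x \<bullet> b) = pi * (y \<bullet> b + 2 * R * of_int n)"
    using R by (simp add: field_simps)
  then have n: "x \<bullet> b = y \<bullet> b + 2 * R * of_int n" by simp
  have xb: "\<bar>x \<bullet> b\<bar> < R" using x b by (auto simp: mem_open_cube)
  have yb: "\<bar>y \<bullet> b\<bar> \<le> R" using y b by (auto simp: mem_box abs_le_iff inner_simps)
  have "\<bar>2 * R * of_int n\<bar> < 2 * R * 1" using n xb yb by linarith
  then have "\<bar>real_of_int n\<bar> < 1" using R by (simp add: abs_mult)
  then have "n = 0" by linarith
  then show "x \<bullet> b = y \<bullet> b" using n by simp
qed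

text \<open>The coordinates of the torus map are cosines and sines, which are combinations of two
  exponentials by Euler's formula; products of trigonometric polynomials are trigonometric polynomials.\<close>

lemma trig_poly_torus:
  assumes R: "0 < R" and g: "real_polynomial_function g"
  shows "trig_poly (cube_lattice R) (\<lambda>x. of_real (g (torus_map R x)))"
  using g
proof induction
  case (linear g)
  interpret g: bounded_linear g by fact
  have ne: "cube_lattice R \<noteq> {}" using cube_lattice_0 by blast
  \<comment> \<open>The generators of the lattice: with these frequencies the exponentials have the phase \<open>\<pi> (x \<bullet> b) / R\<close> of the torus map.\<close>
  define s where "s b = (1 / (2 * R)) *\<^sub>R b" for b :: 'a
  have s: "s b \<in> cube_lattice R" "- s b \<in> cube_lattice R" if "b \<in> Basis" for b
  proof -
    show "s b \<in> cube_lattice R"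
      unfolding cube_lattice_def s_def
    proof safe
      fix c :: 'a assume "c \<in> Basis"
      then show "\<exists>n::int. ((1 / (2 * R)) *\<^sub>R b) \<bullet> c = of_int n / (2 * R)"
        using that by (intro exI[of _ "if b = c then 1 else 0"]) (simp add: inner_Basis)
    qed
    then show "- s b \<in> cube_lattice R" by (rule cube_lattice_minus)
  qed
  have expo_s: "expo (s b) x = exp (\<i> * of_real (pi * (x \<bullet> b) / R))"
    "expo (- s b) x = exp (- (\<i> * of_real (pi * (x \<bullet> b) / R)))" for b x
    by (simp_all add: expo_def s_def inner_commute field_simps)
  define p q where "p b = complex_of_real (g (b, 0))" and "q b = complex_of_real (g (0, b))" for b
  have "of_real (g (torus_map R x)) = (\<Sum>b\<in>Basis. ((p b / 2 + q b / (2 * \<i>)) * expo (s b) x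
      + (p b / 2 - q b / (2 * \<i>)) * expo (- s b) x))" for x
  proof -
    have "torus_map R x = (\<Sum>b\<in>Basis. cos (pi * (x \<bullet> b) / R) *\<^sub>R (b, 0) + sin (pi * (x \<bullet> b) / R) *\<^sub>R (0, b))"
      by (simp add: torus_map_def prod_eq_iff fst_sum snd_sum)
    then have "g (torus_map R x) = (\<Sum>b\<in>Basis. cos (pi * (x \<bullet> b) / R) * g (b, 0) + sin (pi * (x \<bullet> b) / R) * g (0, b))"
      by (simp only: g.sum g.add g.scaleR real_scaleR_def)
    then have "of_real (g (torus_map R x)) = (\<Sum>b\<in>Basis. cos (of_real (pi * (x \<bullet> b) / R)) * p b + sin (of_real (pi * (x \<bullet> b) / R)) * q b)"
      by (simp only: p_def q_def cos_of_real sin_of_real of_real_sum of_real_add of_real_mult)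
    also have "\<dots> = (\<Sum>b\<in>Basis. ((p b / 2 + q b / (2 * \<i>)) * expo (s b) x
      + (p b / 2 - q b / (2 * \<i>)) * expo (- s b) x))"
      unfolding expo_s by (intro sum.cong refl) (simp add: cos_exp_eq sin_exp_eq field_simps)
    finally show ?thesis .
  qed
  then show ?case
    by (simp only:) (intro trig_poly_sum ne trig_poly.intros s)
next
  case (const c)
  show ?case using trig_poly.expo[OF cube_lattice_0, of R "of_real c"] by simp
next
  case (add f g)
  then show ?case by (simp add: trig_poly.add)
next
  case (mult f g)
  then show ?case by (simp add: trig_poly_mult cube_lattice_add)
qed

text \<open>Because \<open>f\<close> vanishes on the boundary of the cube, it is constant on the fibres of the torus map
  and so factors through the torus. The factor \<open>F\<close> is continuous, since the preimage of a closed set under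
  \<open>F\<close> is the image of a compact set. A polynomial approximating \<open>F\<close> pulls back to a trigonometric
  polynomial approximating \<open>f\<close>.\<close>

lemma trig_poly_uniformly_dense:
  fixes f :: "'a::euclidean_space \<Rightarrow> real"
  assumes R: "0 < R" and cont: "continuous_on UNIV f" and zero: "\<And>x. x \<notin> open_cube R \<Longrightarrow> f x = 0" and e: "0 < e"
  obtains T where "trig_poly (cube_lattice R) T" "\<And>x. x \<in> open_cube R \<Longrightarrow> cmod (of_real (f x) - T x) < e"
proof -
  define K :: "'a set" where "K = cbox (- R *\<^sub>R One) (R *\<^sub>R One)"
  have K: "compact K" "open_cube R \<subseteq> K"
    by (auto simp: K_def open_cube_def compact_cbox intro: box_subset_cbox[THEN subsetD])
  define F where "F y = f (SOME x. x \<in> K \<and> torus_map R x = y)" for y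
  have F: "F (torus_map R x) = f x" if x: "x \<in> K" for x
  proof -
    define z where "z = (SOME z. z \<in> K \<and> torus_map R z = torus_map R x)"
    have z: "z \<in> K" "torus_map R z = torus_map R x"
      unfolding z_def using someI[of "\<lambda>z. z \<in> K \<and> torus_map R z = torus_map R x" x] x by auto
    have "f z = f x"
    proof (cases "x \<in> open_cube R \<or> z \<in> open_cube R")
      case True
      then show ?thesis
        using torus_map_eq_imp[OF R z(2)] torus_map_eq_imp[OF R z(2)[symmetric]] x z(1) by (auto simp: K_def)
    qed (simp add: zero)
    then show ?thesis by (simp add: F_def z_def)
  qed
  have contF: "continuous_on (torus_map R ` K) F"
    unfolding continuous_on_closed_invariant
  proof (intro allI impI)
    fix B :: "real set" assume B: "closed B"
    have "closed (f -` B)" using B cont by (intro closed_vimage) auto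
    then have "compact (torus_map R ` (K \<inter> f -` B))"
      by (intro compact_continuous_image continuous_torus_map compact_Int_closed K)
    then have "closed (torus_map R ` (K \<inter> f -` B))" by (rule compact_imp_closed)
    moreover have "torus_map R ` (K \<inter> f -` B) \<inter> torus_map R ` K = F -` B \<inter> torus_map R ` K"
      by (auto simp: F)
    ultimately show "\<exists>A. closed A \<and> A \<inter> torus_map R ` K = F -` B \<inter> torus_map R ` K" by blast
  qed
  obtain g where g: "real_polynomial_function g" "\<And>y. y \<in> torus_map R ` K \<Longrightarrow> \<bar>F y - g y\<bar> < e"
    using Stone_Weierstrass_real_polynomial_function[OF compact_continuous_image[OF continuous_torus_map K(1)] contF e] by blast
  show thesis
  proof (rule that[OF trig_poly_torus[OF R g(1)]])
    fix x :: 'a assume "x \<in> open_cube R"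
    then have "x \<in> K" using K by auto
    then have "\<bar>f x - g (torus_map R x)\<bar> < e" using g(2)[of "torus_map R x"] by (simp add: F)
    then show "cmod (of_real (f x) - of_real (g (torus_map R x))) < e"
      by (metis norm_of_real of_real_diff)
  qed
qed

section \<open>Completeness of the Fourier basis of a cube\<close>

definition (in borel_prob) mean_approximable :: "'a set \<Rightarrow> ('a \<Rightarrow> complex) \<Rightarrow> bool" where
  "mean_approximable \<Lambda> f \<longleftrightarrow> f \<in> Lp M 2 \<and>
     (\<forall>e>0. \<exists>T. trig_poly \<Lambda> T \<and> (\<integral>x. (cmod (f x - T x))\<^sup>2 \<partial>M) < e)"

text \<open>A substitute for the triangle inequality that suffices for density arguments and follows
  pointwise.\<close>

lemma (in borel_prob) mean_square_triangle:
  assumes "f \<in> Lp M 2" "g \<in> Lp M 2"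
  shows "(\<integral>x. (cmod (f x + g x))\<^sup>2 \<partial>M) \<le> 2 * (\<integral>x. (cmod (f x))\<^sup>2 \<partial>M) + 2 * (\<integral>x. (cmod (g x))\<^sup>2 \<partial>M)"
proof -
  have "(\<integral>x. (cmod (f x + g x))\<^sup>2 \<partial>M) \<le> (\<integral>x. 2 * (cmod (f x))\<^sup>2 + 2 * (cmod (g x))\<^sup>2 \<partial>M)"
    using assms Lp_2_add[OF assms] by (intro integral_mono norm_add_square_le) (auto simp: Lp_2_iff)
  also have "\<dots> = 2 * (\<integral>x. (cmod (f x))\<^sup>2 \<partial>M) + 2 * (\<integral>x. (cmod (g x))\<^sup>2 \<partial>M)"
    using assms by (simp add: Lp_2_iff)
  finally show ?thesis .
qed

lemma Lp_2_diff: "f \<in> Lp \<mu> 2 \<Longrightarrow> g \<in> Lp \<mu> 2 \<Longrightarrow> (\<lambda>x. f x - g x) \<in> Lp \<mu> 2"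
  using Lp_2_add[of f \<mu> "\<lambda>x. - 1 * g x"] Lp_2_scale[of g \<mu> "- 1"] by simp

lemma (in borel_prob) mean_approximable_limit:
  assumes f: "f \<in> Lp M 2"
    and lim: "\<And>e. 0 < e \<Longrightarrow> \<exists>g. mean_approximable \<Lambda> g \<and> (\<integral>x. (cmod (f x - g x))\<^sup>2 \<partial>M) < e"
  shows "mean_approximable \<Lambda> f"
  unfolding mean_approximable_def
proof (intro conjI f allI impI)
  fix e :: real assume e: "0 < e"
  then obtain g where g: "mean_approximable \<Lambda> g" "(\<integral>x. (cmod (f x - g x))\<^sup>2 \<partial>M) < e / 4"
    using lim[of "e / 4"] by auto
  obtain T where T: "trig_poly \<Lambda> T" "(\<integral>x. (cmod (g x - T x))\<^sup>2 \<partial>M) < e / 4"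
    using g(1) e unfolding mean_approximable_def by (metis divide_pos_pos zero_less_numeral)
  have "g \<in> Lp M 2" using g(1) by (simp add: mean_approximable_def)
  then have "(\<integral>x. (cmod ((f x - g x) + (g x - T x)))\<^sup>2 \<partial>M)
      \<le> 2 * (\<integral>x. (cmod (f x - g x))\<^sup>2 \<partial>M) + 2 * (\<integral>x. (cmod (g x - T x))\<^sup>2 \<partial>M)"
    by (intro mean_square_triangle Lp_2_diff f trig_poly_Lp_2[OF T(1)])
  then have "(\<integral>x. (cmod (f x - T x))\<^sup>2 \<partial>M) < e" using g(2) T(2) by simp
  then show "\<exists>T. trig_poly \<Lambda> T \<and> (\<integral>x. (cmod (f x - T x))\<^sup>2 \<partial>M) < e" using T(1) by auto
qed

lemma (in borel_prob) mean_approximable_trig_poly: "trig_poly \<Lambda> T \<Longrightarrow> mean_approximable \<Lambda> T"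
  unfolding mean_approximable_def by (auto simp: trig_poly_Lp_2 intro!: exI[of _ T])

lemma (in borel_prob) mean_approximable_add:
  assumes f: "mean_approximable \<Lambda> f" and g: "mean_approximable \<Lambda> g"
  shows "mean_approximable \<Lambda> (\<lambda>x. f x + g x)"
  unfolding mean_approximable_def
proof (intro conjI allI impI)
  show "(\<lambda>x. f x + g x) \<in> Lp M 2" using f g by (auto simp: mean_approximable_def intro: Lp_2_add)
  fix e :: real assume "0 < e"
  then have e4: "0 < e / 4" by simp
  obtain S where S: "trig_poly \<Lambda> S" "(\<integral>x. (cmod (f x - S x))\<^sup>2 \<partial>M) < e / 4"
    using f e4 unfolding mean_approximable_def by blast
  obtain T where T: "trig_poly \<Lambda> T" "(\<integral>x. (cmod (g x - T x))\<^sup>2 \<partial>M) < e / 4"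
    using g e4 unfolding mean_approximable_def by blast
  have "f \<in> Lp M 2" "g \<in> Lp M 2" using f g by (auto simp: mean_approximable_def)
  then have "(\<integral>x. (cmod ((f x - S x) + (g x - T x)))\<^sup>2 \<partial>M)
      \<le> 2 * (\<integral>x. (cmod (f x - S x))\<^sup>2 \<partial>M) + 2 * (\<integral>x. (cmod (g x - T x))\<^sup>2 \<partial>M)"
    by (intro mean_square_triangle Lp_2_diff trig_poly_Lp_2[OF S(1)] trig_poly_Lp_2[OF T(1)])
  then have "(\<integral>x. (cmod ((f x - S x) + (g x - T x)))\<^sup>2 \<partial>M) < e" using S(2) T(2) by linarith
  then show "\<exists>T. trig_poly \<Lambda> T \<and> (\<integral>x. (cmod (f x + g x - T x))\<^sup>2 \<partial>M) < e"
    using S(1) T(1) by (intro exI[of _ "\<lambda>x. S x + T x"]) (auto simp: trig_poly.add algebra_simps)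
qed

lemma trig_poly_scale: "trig_poly \<Lambda> T \<Longrightarrow> trig_poly \<Lambda> (\<lambda>x. c * T x)"
proof (induction rule: trig_poly.induct)
  case (expo l d)
  then show ?case using trig_poly.expo[of l \<Lambda> "c * d"] by (simp add: mult.assoc)
next
  case (add f g)
  then show ?case by (simp add: distrib_left trig_poly.add)
qed

lemma (in borel_prob) mean_approximable_scale:
  assumes f: "mean_approximable \<Lambda> f"
  shows "mean_approximable \<Lambda> (\<lambda>x. c * f x)"
proof (cases "c = 0")
  case True
  obtain T where "trig_poly \<Lambda> T" using f unfolding mean_approximable_def by (meson zero_less_one)
  then show ?thesis using mean_approximable_trig_poly[OF trig_poly_scale[of \<Lambda> T 0]] True by simp
next
  case False
  show ?thesis
    unfolding mean_approximable_def
  proof (intro conjI allI impI)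
    show "(\<lambda>x. c * f x) \<in> Lp M 2" using f by (auto simp: mean_approximable_def intro: Lp_2_scale)
    fix e :: real assume "0 < e"
    then have "0 < e / (cmod c)\<^sup>2" using False by simp
    then obtain T where T: "trig_poly \<Lambda> T" "(\<integral>x. (cmod (f x - T x))\<^sup>2 \<partial>M) < e / (cmod c)\<^sup>2"
      using f unfolding mean_approximable_def by blast
    have "(\<integral>x. (cmod (c * f x - c * T x))\<^sup>2 \<partial>M) = (cmod c)\<^sup>2 * (\<integral>x. (cmod (f x - T x))\<^sup>2 \<partial>M)"
      by (simp add: norm_mult power_mult_distrib flip: right_diff_distrib)
    also have "\<dots> < e" using T(2) False by (simp add: field_simps)
    finally show "\<exists>T. trig_poly \<Lambda> T \<and> (\<integral>x. (cmod (c * f x - T x))\<^sup>2 \<partial>M) < e"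
      using trig_poly_scale[OF T(1)] by blast
  qed
qed

lemma (in borel_prob) mean_approximable_sum:
  assumes "mean_approximable \<Lambda> (\<lambda>x. 0)" "\<And>i. i \<in> I \<Longrightarrow> mean_approximable \<Lambda> (f i)"
  shows "mean_approximable \<Lambda> (\<lambda>x. \<Sum>i\<in>I. f i x)"
proof (cases "finite I")
  case True
  then show ?thesis using assms(2)
    by (induction I) (auto intro: mean_approximable_add assms(1))
qed (simp add: assms(1))

text \<open>The approximable functions are closed under linear combinations and mean square limits; simple
  functions dominated by \<open>2 |f|\<close> converge to \<open>f\<close> in mean square.\<close>

lemma (in borel_prob) mean_approximable_all:
  assumes ind: "\<And>A. A \<in> sets borel \<Longrightarrow> mean_approximable \<Lambda> (indicator A)" and f: "f \<in> Lp M 2"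
  shows "mean_approximable \<Lambda> f"
proof -
  have [measurable]: "f \<in> borel_measurable M" and int: "integrable M (\<lambda>x. (cmod (f x))\<^sup>2)"
    using f by (auto simp: Lp_2_iff)
  have space: "space M = UNIV" using sets_eq_imp_space_eq[OF sets_eq_borel] by simp
  obtain s where s: "\<And>n. simple_function M (s n)"
    and lim: "\<And>x. (\<lambda>n. s n x) \<longlonglongrightarrow> f x" and dom: "\<And>n x. cmod (s n x) \<le> 2 * cmod (f x)"
    using borel_measurable_implies_sequence_metric[OF \<open>f \<in> borel_measurable M\<close>, of 0]
    unfolding dist_0_norm dist_norm diff_zero space by blast
  have [measurable]: "s n \<in> borel_measurable M" for n using s by (rule borel_measurable_simple_function)
  have simple: "mean_approximable \<Lambda> (s n)" for n
  proof -
    have fin: "finite (range (s n))" using simple_functionD(1)[OF s[of n]] by (simp add: space)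
    have "s n -` {y} \<in> sets M" for y using simple_functionD(2)[OF s[of n], of "{y}"] by (simp add: space)
    moreover have "mean_approximable \<Lambda> (\<lambda>x. 0)"
      using ind[of "{}"] by (simp add: indicator_def[abs_def])
    ultimately have "mean_approximable \<Lambda> (\<lambda>x. \<Sum>y\<in>range (s n). y * indicator (s n -` {y}) x)"
      by (intro mean_approximable_sum mean_approximable_scale ind) auto
    also have "(\<lambda>x. \<Sum>y\<in>range (s n). y * indicator (s n -` {y}) x) = s n"
    proof
      fix x
      show "(\<Sum>y\<in>range (s n). y * indicator (s n -` {y}) x) = s n x"
        using fin by (subst sum.remove[of _ "s n x"]) (auto intro!: sum.neutral simp: indicator_def)
    qed
    finally show ?thesis .
  qed
  have "(\<lambda>n. \<integral>x. (cmod (f x - s n x))\<^sup>2 \<partial>M) \<longlonglongrightarrow> (\<integral>x. 0 \<partial>M)"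
  proof (rule integral_dominated_convergence)
    show "integrable M (\<lambda>x. 9 * (cmod (f x))\<^sup>2)" using int by simp
    show "AE x in M. (\<lambda>n. (cmod (f x - s n x))\<^sup>2) \<longlonglongrightarrow> 0"
    proof (rule AE_I2)
      fix x
      have "(\<lambda>n. (cmod (f x - s n x))\<^sup>2) \<longlonglongrightarrow> (cmod (f x - f x))\<^sup>2"
        by (intro tendsto_intros lim)
      then show "(\<lambda>n. (cmod (f x - s n x))\<^sup>2) \<longlonglongrightarrow> 0" by simp
    qed
    show "AE x in M. norm ((cmod (f x - s n x))\<^sup>2) \<le> 9 * (cmod (f x))\<^sup>2" for n
    proof (rule AE_I2)
      fix x
      have "cmod (f x - s n x) \<le> 3 * cmod (f x)"
        using norm_triangle_ineq4[of "f x" "s n x"] dom[of n x] by linarith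
      then have "(cmod (f x - s n x))\<^sup>2 \<le> (3 * cmod (f x))\<^sup>2" by (intro power_mono) auto
      then show "norm ((cmod (f x - s n x))\<^sup>2) \<le> 9 * (cmod (f x))\<^sup>2" by (simp add: power_mult_distrib)
    qed
  qed measurable
  then have lim0: "(\<lambda>n. \<integral>x. (cmod (f x - s n x))\<^sup>2 \<partial>M) \<longlonglongrightarrow> 0" by simp
  show ?thesis
  proof (rule mean_approximable_limit[OF f])
    fix e :: real assume "0 < e"
    then have "\<forall>\<^sub>F n in sequentially. (\<integral>x. (cmod (f x - s n x))\<^sup>2 \<partial>M) < e"
      using lim0 by (rule order_tendstoD(2)[rotated])
    then obtain n where "(\<integral>x. (cmod (f x - s n x))\<^sup>2 \<partial>M) < e" by (auto simp: eventually_sequentially)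
    then show "\<exists>g. mean_approximable \<Lambda> g \<and> (\<integral>x. (cmod (f x - g x))\<^sup>2 \<partial>M) < e" using simple by blast
  qed
qed

lemma (in borel_prob) mean_square_less_of_bound:
  assumes meas: "g \<in> borel_measurable M" and bound: "AE x in M. cmod (g x) \<le> e" and e: "0 < e" "e < 1"
  shows "(\<integral>x. (cmod (g x))\<^sup>2 \<partial>M) \<le> e"
proof -
  note [measurable] = meas
  have le: "AE x in M. (cmod (g x))\<^sup>2 \<le> e"
    using bound
  proof eventually_elim
    case (elim x)
    then have "(cmod (g x))\<^sup>2 \<le> e\<^sup>2" by (intro power_mono) auto
    also have "\<dots> \<le> e" using e by (simp add: power2_eq_square mult_left_le)
    finally show ?case .
  qed
  have int: "integrable M (\<lambda>x. (cmod (g x))\<^sup>2)"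
    using le by (intro integrable_const_bound[of _ e]) auto
  have "(\<integral>x. (cmod (g x))\<^sup>2 \<partial>M) \<le> (\<integral>x. e \<partial>M)"
    using le int by (intro integral_mono_AE) auto
  then show "(\<integral>x. (cmod (g x))\<^sup>2 \<partial>M) \<le> e" by (simp add: prob_space)
qed

lemma emeasure_cube_prob_le:
  assumes "0 < R" "A \<in> sets borel"
  shows "emeasure (cube_prob R :: 'a::euclidean_space measure) A \<le> ennreal (1 / (2 * R) ^ DIM('a)) * emeasure lborel A"
proof -
  have "emeasure (cube_prob R :: 'a measure) A
      = (\<integral>\<^sup>+x. ennreal (indicator (open_cube R) x / (2 * R) ^ DIM('a)) * indicator A x \<partial>lborel)"
    unfolding cube_prob_def using assms by (intro emeasure_density) auto
  also have "\<dots> \<le> (\<integral>\<^sup>+x. ennreal (1 / (2 * R) ^ DIM('a)) * indicator A x \<partial>lborel)"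
    using assms(1) by (intro nn_integral_mono) (auto split: split_indicator)
  also have "\<dots> = ennreal (1 / (2 * R) ^ DIM('a)) * emeasure lborel A"
    using assms by (simp add: nn_integral_cmult_indicator)
  finally show ?thesis .
qed

lemma AE_cube_prob: "0 < R \<Longrightarrow> AE x in cube_prob R. x \<in> open_cube R"
  unfolding cube_prob_def by (subst AE_density) (auto split: split_indicator)

lemma closed_open_sandwich:
  fixes A B :: "'a::euclidean_space set"
  assumes A: "A \<in> sets borel" "A \<subseteq> B" "open B" and e: "0 < e"
  obtains K W where "closed K" "open W" "K \<subseteq> A" "A \<subseteq> W" "W \<subseteq> B" "emeasure lborel (W - K) < ennreal e"
proof -
  have "A \<in> sets lebesgue" using A by simp
  then obtain K where K: "closed K" "K \<subseteq> A" "emeasure lebesgue (A - K) < ennreal (e / 2)"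
    using e by (metis sets_lebesgue_inner_closed half_gt_zero)
  obtain W where W: "open W" "A \<subseteq> W" "emeasure lebesgue (W - A) < ennreal (e / 2)"
    using e \<open>A \<in> sets lebesgue\<close> by (metis sets_lebesgue_outer_open half_gt_zero)
  have meas: "A - K \<in> sets borel" "W - A \<in> sets borel" "W - K \<in> sets borel" "W \<inter> B - K \<in> sets borel" using A K W by auto
  show thesis
  proof (rule that[of K "W \<inter> B"])
    have "emeasure lborel (W \<inter> B - K) \<le> emeasure lborel (W - K)"
      using meas by (intro emeasure_mono) auto
    also have "\<dots> \<le> emeasure lborel ((W - A) \<union> (A - K))"
      using meas by (intro emeasure_mono) auto
    also have "\<dots> \<le> emeasure lborel (W - A) + emeasure lborel (A - K)"
      using meas by (intro emeasure_subadditive) auto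
    also have "\<dots> < ennreal (e / 2) + ennreal (e / 2)"
      using K W meas by (intro add_strict_mono) auto
    also have "\<dots> = ennreal e" using e by (simp flip: ennreal_plus)
    finally show "emeasure lborel (W \<inter> B - K) < ennreal e" .
  qed (use K W A in auto)
qed

text \<open>A closed set \<open>K\<close> and an open set \<open>W\<close> enclose the part of \<open>A\<close> in the cube, with a difference of small
  measure. An Urysohn function for \<open>K\<close> and \<open>W\<close> differs from the indicator function only on that
  difference; being supported in the open cube, it is a uniform limit of trigonometric polynomials.\<close>

lemma cube_indicator_approximable:
  fixes A :: "'a::euclidean_space set"
  assumes R: "0 < R" and A: "A \<in> sets borel"
  shows "borel_prob.mean_approximable (cube_prob R) (cube_lattice R) (indicator A)"
proof -
  interpret borel_prob "cube_prob R :: 'a measure" using R by (rule borel_prob_cube_prob)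
  have ind_Lp: "(indicator A :: 'a \<Rightarrow> complex) \<in> Lp (cube_prob R) 2"
    using A by (auto simp: Lp_2_iff intro!: integrable_const_bound[of _ 1] split: split_indicator)
  show ?thesis
  proof (rule mean_approximable_limit[OF ind_Lp])
    fix e :: real assume e: "0 < e"
    have "0 < e * (2 * R) ^ DIM('a)" using e R by simp
    moreover have "A \<inter> open_cube R \<in> sets borel" using A by auto
    ultimately obtain K W where KW: "closed K" "open W" "K \<subseteq> A \<inter> open_cube R" "A \<inter> open_cube R \<subseteq> W" "W \<subseteq> open_cube R"
      and small: "emeasure lborel (W - K) < ennreal (e * (2 * R) ^ DIM('a))"
      using closed_open_sandwich[of "A \<inter> open_cube R" "open_cube R" "e * (2 * R) ^ DIM('a)"] by auto
    obtain g :: "'a \<Rightarrow> real" where g: "continuous_on UNIV g" "\<And>x. g x \<in> closed_segment 1 0"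
      "\<And>x. x \<in> K \<Longrightarrow> g x = 1" "\<And>x. x \<in> - W \<Longrightarrow> g x = 0"
      using Urysohn[of K "- W" 1 0] KW by (metis closed_Compl Diff_disjoint Compl_eq_Diff_UNIV disjoint_eq_subset_Compl double_compl subset_trans)
    have g01: "0 \<le> g x" "g x \<le> 1" for x using g(2)[of x] by (auto simp: closed_segment_eq_real_ivl)
    have [measurable]: "g \<in> borel_measurable borel" using g(1) by (rule borel_measurable_continuous_onI)
    have g_Lp: "(\<lambda>x. of_real (g x) :: complex) \<in> Lp (cube_prob R) 2"
      unfolding Lp_2_iff using g01
      by (auto intro!: integrable_const_bound[of _ 1] simp: abs_le_square_iff[of _ 1, simplified] power_le_one)
    have "mean_approximable (cube_lattice R) (\<lambda>x. of_real (g x))"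
      unfolding mean_approximable_def
    proof (intro conjI g_Lp allI impI)
      fix d :: real assume d: "0 < d"
      \<comment> \<open>Below one, so that the square of the uniform error is at most the error itself.\<close>
      define d' where "d' = min d 1 / 2"
      have d': "0 < d'" "d' < 1" "d' < d" using d by (auto simp: d'_def)
      have zero: "g x = 0" if "x \<notin> open_cube R" for x using that KW g(4) by auto
      obtain T where T: "trig_poly (cube_lattice R) T" "\<And>x. x \<in> open_cube R \<Longrightarrow> cmod (of_real (g x) - T x) < d'"
        using trig_poly_uniformly_dense[OF R g(1) zero d'(1)] by blast
      have [measurable]: "T \<in> borel_measurable (cube_prob R)" using trig_poly_Lp_2[OF T(1)] by (simp add: Lp_def)
      have "AE x in cube_prob R. cmod (of_real (g x) - T x) \<le> d'"
        using AE_cube_prob[OF R] by eventually_elim (use T(2) in \<open>auto intro: less_imp_le\<close>)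
      then have "(\<integral>x. (cmod (of_real (g x) - T x))\<^sup>2 \<partial>cube_prob R) \<le> d'"
        using d' by (intro mean_square_less_of_bound) auto
      then show "\<exists>T. trig_poly (cube_lattice R) T \<and> (\<integral>x. (cmod (of_real (g x) - T x))\<^sup>2 \<partial>cube_prob R) < d"
        using T(1) d' by (intro exI[of _ T]) auto
    qed
    moreover have "(\<integral>x. (cmod (indicator A x - of_real (g x)))\<^sup>2 \<partial>cube_prob R) < e"
    proof -
      have meas: "W - K \<in> sets borel" using KW by auto
      have "(\<integral>x. (cmod (indicator A x - of_real (g x)))\<^sup>2 \<partial>cube_prob R) \<le> (\<integral>x. indicator (W - K) x \<partial>cube_prob R)"
      proof (rule integral_mono_AE)
        show "integrable (cube_prob R) (\<lambda>x. (cmod (indicator A x - of_real (g x)))\<^sup>2)"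
          using Lp_2_diff[OF ind_Lp g_Lp] by (simp add: Lp_2_iff)
        show "integrable (cube_prob R) (indicator (W - K) :: 'a \<Rightarrow> real)"
          using meas by (intro integrable_const_bound[of _ 1]) auto
        show "AE x in cube_prob R. (cmod (indicator A x - of_real (g x)))\<^sup>2 \<le> indicator (W - K) x"
          using AE_cube_prob[OF R]
        proof eventually_elim
          case (elim x)
          consider "x \<in> K" | "x \<notin> W" | "x \<in> W - K" by blast
          then show ?case
          proof cases
            case 1
            then show ?thesis using KW g(3) by (auto simp: indicator_def)
          next
            case 2
            then show ?thesis using KW g(4) elim by (auto simp: indicator_def)
          next
            case 3
            have "cmod (indicator A x - of_real (g x)) = \<bar>indicator A x - g x\<bar>"
              by (metis norm_of_real of_real_diff of_real_indicator)
            also have "\<dots> \<le> 1" using g01[of x] by (auto simp: indicator_def)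
            finally show ?thesis using 3 by (simp add: power_le_one)
          qed
        qed
      qed
      also have "\<dots> = measure (cube_prob R) (W - K)" using meas by simp
      also have "\<dots> < e"
      proof -
        have "emeasure (cube_prob R) (W - K) \<le> ennreal (1 / (2 * R) ^ DIM('a)) * emeasure lborel (W - K)"
          using R meas by (rule emeasure_cube_prob_le)
        also have "\<dots> < ennreal (1 / (2 * R) ^ DIM('a)) * ennreal (e * (2 * R) ^ DIM('a))"
          using R by (intro ennreal_mult_strict_left_mono small) auto
        also have "\<dots> = ennreal e" using R e by (simp flip: ennreal_mult)
        finally show ?thesis using e by (simp add: emeasure_eq_measure ennreal_less_iff)
      qed
      finally show ?thesis .
    qed
    ultimately show "\<exists>g. mean_approximable (cube_lattice R) g \<and> (\<integral>x. (cmod (indicator A x - g x))\<^sup>2 \<partial>cube_prob R) < e"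
      by blast
  qed
qed

proposition cube_lattice_spectrum:
  assumes R: "0 < R"
  shows "is_spectrum (cube_prob R :: 'a::euclidean_space measure) (cube_lattice R)"
  unfolding is_spectrum_def
proof (intro conjI)
  interpret borel_prob "cube_prob R :: 'a measure" using R by (rule borel_prob_cube_prob)
  show "countable (cube_lattice R :: 'a set)" by (rule countable_cube_lattice)
  show "\<forall>k\<in>cube_lattice R. \<forall>l\<in>cube_lattice R. L2_inner (cube_prob R :: 'a measure) (expo k) (expo l) = (if k = l then 1 else 0)"
    using cube_lattice_orthonormal[OF R, where ?'a = 'a] by (simp add: orthonormal_expo_def)
  show "\<forall>f\<in>Lp (cube_prob R :: 'a measure) 2. \<forall>e>0. \<exists>F c. finite F \<and> F \<subseteq> cube_lattice R \<and>
      Lp_norm (cube_prob R) 2 (\<lambda>x. f x - (\<Sum>l\<in>F. c l * expo l x)) < e"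
  proof (intro ballI allI impI)
    fix f :: "'a \<Rightarrow> complex" and e :: real assume f: "f \<in> Lp (cube_prob R) 2" and e: "0 < e"
    have "mean_approximable (cube_lattice R) f"
      by (rule mean_approximable_all[OF cube_indicator_approximable[OF R] f])
    then obtain T where T: "trig_poly (cube_lattice R) T" "(\<integral>x. (cmod (f x - T x))\<^sup>2 \<partial>cube_prob R) < e\<^sup>2"
      using e unfolding mean_approximable_def by (meson zero_less_power)
    have "Lp_norm (cube_prob R) 2 (\<lambda>x. f x - T x) < e"
      using T(2) e unfolding Lp_norm_2_square[symmetric] by (rule power_less_imp_less_base[OF _ less_imp_le])
    then show "\<exists>F c. finite F \<and> F \<subseteq> cube_lattice R \<and>
      Lp_norm (cube_prob R) 2 (\<lambda>x. f x - (\<Sum>l\<in>F. c l * expo l x)) < e"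
      using trig_poly_imp_sum[OF T(1)] by blast
  qed
qed

section \<open>Frames from densities bounded above and below\<close>

text \<open>The coefficients of \<open>f\<close> with respect to \<open>\<mu>\<close> are those of \<open>\<psi> f\<close> with respect to \<open>M\<close>, so by Parseval's
  identity the sum of their squares is the integral of \<open>\<psi>\<^sup>2 |f|\<^sup>2\<close> against \<open>M\<close>, that is, of
  \<open>\<psi> |f|\<^sup>2\<close> against \<open>\<mu>\<close>.\<close>

proposition (in borel_prob) F_spectrum_of_bounded_density:
  assumes sp: "is_spectrum M \<Lambda>" and \<psi>: "\<psi> \<in> borel_measurable borel" "\<And>x. 0 \<le> \<psi> x"
    and \<mu>: "\<mu> = density M (\<lambda>x. ennreal (\<psi> x))" and bounds: "AE x in \<mu>. a \<le> \<psi> x \<and> \<psi> x \<le> b" and ab: "0 < a" "a \<le> b"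
  shows "is_F_spectrum \<mu> \<Lambda>"
  unfolding is_F_spectrum_def
proof (rule conjI, use sp in \<open>simp add: is_spectrum_def\<close>,
    rule exI[of _ a], rule conjI[OF ab(1)], rule exI[of _ b], intro conjI ballI)
  show "0 < b" using ab by simp
  have [measurable]: "\<psi> \<in> borel_measurable M" using \<psi>(1) by simp
  have sets_\<mu>: "sets \<mu> = sets M" by (simp add: \<mu>)
  fix f assume f: "f \<in> Lp \<mu> 2"
  have f_int: "integrable \<mu> (\<lambda>x. (cmod (f x))\<^sup>2)" and "f \<in> borel_measurable \<mu>" using f by (auto simp: Lp_2_iff)
  then have [measurable]: "f \<in> borel_measurable M" using measurable_cong_sets[OF sets_\<mu> refl] by blast
  have [measurable]: "f \<in> borel_measurable \<mu>" "\<psi> \<in> borel_measurable \<mu>"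
    using \<open>f \<in> borel_measurable M\<close> \<open>\<psi> \<in> borel_measurable M\<close> measurable_cong_sets[OF sets_\<mu> refl] by blast+
  define h where "h x = \<psi> x *\<^sub>R f x" for x
  have h_square: "(cmod (h x))\<^sup>2 = \<psi> x *\<^sub>R (\<psi> x * (cmod (f x))\<^sup>2)" for x
    by (simp add: h_def power2_eq_square)
  have wint: "integrable \<mu> (\<lambda>x. \<psi> x * (cmod (f x))\<^sup>2)"
  proof (rule Bochner_Integration.integrable_bound)
    show "integrable \<mu> (\<lambda>x. b * (cmod (f x))\<^sup>2)" using f_int by simp
    show "AE x in \<mu>. norm (\<psi> x * (cmod (f x))\<^sup>2) \<le> norm (b * (cmod (f x))\<^sup>2)"
      using bounds by eventually_elim (auto simp: abs_mult \<psi>(2) intro!: mult_right_mono)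
  qed measurable
  have h: "h \<in> Lp M 2"
    unfolding Lp_2_iff
  proof
    show "h \<in> borel_measurable M" unfolding h_def by measurable
    show "integrable M (\<lambda>x. (cmod (h x))\<^sup>2)"
      unfolding h_square using wint unfolding \<mu> by (subst (asm) integrable_density) (auto simp: \<psi>)
  qed
  have inner: "L2_inner \<mu> f (expo l) = L2_inner M h (expo l)" for l
  proof -
    have [measurable]: "expo l \<in> borel_measurable M" using expo_Lp[of l 2] by (simp add: Lp_def)
    show ?thesis
      unfolding L2_inner_def \<mu> h_def by (subst integral_density) (auto simp: \<psi>)
  qed
  have norm_h: "(\<integral>x. (cmod (h x))\<^sup>2 \<partial>M) = (\<integral>x. \<psi> x * (cmod (f x))\<^sup>2 \<partial>\<mu>)"
    unfolding h_square \<mu> by (subst integral_density) (auto simp: \<psi>)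
  have "a * (\<integral>x. (cmod (f x))\<^sup>2 \<partial>\<mu>) = (\<integral>x. a * (cmod (f x))\<^sup>2 \<partial>\<mu>)" by simp
  also have "\<dots> \<le> (\<integral>x. \<psi> x * (cmod (f x))\<^sup>2 \<partial>\<mu>)"
  proof (rule integral_mono_AE)
    show "AE x in \<mu>. a * (cmod (f x))\<^sup>2 \<le> \<psi> x * (cmod (f x))\<^sup>2"
      using bounds by eventually_elim (auto intro: mult_right_mono)
  qed (use f_int wint in auto)
  finally show "ennreal (a * (Lp_norm \<mu> 2 f)\<^sup>2) \<le> (\<integral>\<^sup>+l. ennreal ((cmod (L2_inner \<mu> f (expo l)))\<^sup>2) \<partial>count_space \<Lambda>)"
    unfolding inner parseval[OF sp h] norm_h Lp_norm_2_square by (rule ennreal_leI)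
  have "(\<integral>x. \<psi> x * (cmod (f x))\<^sup>2 \<partial>\<mu>) \<le> (\<integral>x. b * (cmod (f x))\<^sup>2 \<partial>\<mu>)"
  proof (rule integral_mono_AE)
    show "AE x in \<mu>. \<psi> x * (cmod (f x))\<^sup>2 \<le> b * (cmod (f x))\<^sup>2"
      using bounds by eventually_elim (auto intro: mult_right_mono)
  qed (use f_int wint in auto)
  also have "\<dots> = b * (\<integral>x. (cmod (f x))\<^sup>2 \<partial>\<mu>)" by simp
  finally show "(\<integral>\<^sup>+l. ennreal ((cmod (L2_inner \<mu> f (expo l)))\<^sup>2) \<partial>count_space \<Lambda>) \<le> ennreal (b * (Lp_norm \<mu> 2 f)\<^sup>2)"
    unfolding inner parseval[OF sp h] norm_h Lp_norm_2_square by (rule ennreal_leI)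
qed

section \<open>Spectra of diffuse measures are infinite\<close>

text \<open>The complement of the support is a union of open null sets; by Lindelof's theorem countably many
  of them suffice.\<close>

lemma (in borel_prob) AE_msupport: "AE x in M. x \<in> msupport M"
proof -
  define \<U> where "\<U> = {U :: 'a set. open U \<and> emeasure M U = 0}"
  obtain \<V> where \<V>: "\<V> \<subseteq> \<U>" "countable \<V>" "\<Union>\<V> = \<Union>\<U>"
    using Lindelof[of \<U>] by (auto simp: \<U>_def)
  have "AE x in M. \<forall>U\<in>\<V>. x \<notin> U"
  proof (subst AE_ball_countable[OF \<V>(2)], intro ballI)
    fix U assume "U \<in> \<V>"
    then have "U \<in> null_sets M" using \<V>(1) by (auto simp: \<U>_def null_sets_def)
    then show "AE x in M. x \<notin> U" by (rule AE_not_in)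
  qed
  then show ?thesis
  proof eventually_elim
    case (elim x)
    then have "x \<notin> \<Union>\<U>" using \<V>(3) by auto
    then show ?case by (auto simp: \<U>_def msupport_def zero_less_iff_neq_zero)
  qed
qed

text \<open>Let \<open>A\<close> be a set of measure \<open>c\<close>. Each coefficient of its indicator function is at most \<open>c\<close> in
  modulus, so Parseval's identity for a spectrum with \<open>n\<close> elements gives \<open>c \<le> n c\<^sup>2\<close>. Small balls around a point
  of the support have positive measures that tend to zero, which contradicts this.\<close>

proposition (in borel_prob) spectrum_infinite:
  assumes diffuse: "\<And>x. emeasure M {x} = 0" and sp: "is_spectrum M \<Lambda>"
  shows "infinite \<Lambda>"
proof
  assume fin: "finite \<Lambda>"
  obtain x where x: "x \<in> msupport M"
    using AE_msupport AE_False by (cases "msupport M = {}") auto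
  define A where "A n = ball x (1 / Suc n)" for n :: nat
  have pos: "0 < measure M (A n)" for n
  proof -
    have "0 < emeasure M (A n)" using x by (auto simp: msupport_def A_def)
    then show ?thesis by (simp add: emeasure_eq_measure)
  qed
  have "(\<lambda>n. measure M (A n)) \<longlonglongrightarrow> measure M (\<Inter>n. A n)"
  proof (rule finite_Lim_measure_decseq)
    show "range A \<subseteq> sets M" by (auto simp: A_def)
    show "decseq A" unfolding A_def by (intro decseq_SucI subset_ball) (simp add: frac_le)
  qed
  also have "(\<Inter>n. A n) = {x}"
  proof -
    have "y = x" if "\<forall>n. dist x y < 1 / Suc n" for y
    proof (rule ccontr)
      assume "y \<noteq> x"
      then obtain n where "inverse (real (Suc n)) < dist x y" using reals_Archimedean[of "dist x y"] by auto
      then show False using that[rule_format, of n] by (simp add: inverse_eq_divide)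
    qed
    then show ?thesis by (auto simp: A_def)
  qed
  also have "measure M {x} = 0" using diffuse by (simp add: measure_def)
  finally have lim: "(\<lambda>n. measure M (A n)) \<longlonglongrightarrow> 0" .
  have "0 < 1 / (real (card \<Lambda>) + 1)" by simp
  then have "\<forall>\<^sub>F n in sequentially. measure M (A n) < 1 / (real (card \<Lambda>) + 1)"
    using lim by (rule order_tendstoD(2)[rotated])
  then obtain n where "measure M (A n) < 1 / (real (card \<Lambda>) + 1)" by (auto simp: eventually_sequentially)
  moreover define c where "c = measure M (A n)"
  ultimately have c: "0 < c" "card \<Lambda> * c < 1" using pos[of n] by (auto simp: field_simps)
  define f :: "'a \<Rightarrow> complex" where "f = indicator (A n)"
  have An: "A n \<in> sets M" by (simp add: A_def)
  have f: "f \<in> Lp M 2"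
    using An unfolding f_def Lp_2_iff by (auto intro!: integrable_const_bound[of _ 1] split: split_indicator)
  have norm_f: "(\<integral>x. (cmod (f x))\<^sup>2 \<partial>M) = c"
  proof -
    have "(cmod (f x))\<^sup>2 = indicator (A n) x" for x by (simp add: f_def indicator_def)
    then show ?thesis using An by (simp add: c_def)
  qed
  have le: "cmod (L2_inner M f (expo l)) \<le> c" for l
  proof -
    have "cmod (L2_inner M f (expo l)) \<le> (\<integral>x. cmod (f x * cnj (expo l x)) \<partial>M)"
      unfolding L2_inner_def by (rule integral_norm_bound)
    also have "\<dots> = (\<integral>x. indicator (A n) x \<partial>M)"
      by (intro Bochner_Integration.integral_cong) (auto simp: f_def norm_mult indicator_def)
    finally show ?thesis using An by (simp add: c_def)
  qed
  have "ennreal c = (\<integral>\<^sup>+l. ennreal ((cmod (L2_inner M f (expo l)))\<^sup>2) \<partial>count_space \<Lambda>)"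
    unfolding parseval[OF sp f] norm_f ..
  also have "\<dots> = ennreal (\<Sum>l\<in>\<Lambda>. (cmod (L2_inner M f (expo l)))\<^sup>2)"
    using fin by (simp add: nn_integral_count_space_finite sum_ennreal)
  finally have "c = (\<Sum>l\<in>\<Lambda>. (cmod (L2_inner M f (expo l)))\<^sup>2)"
    using c(1) by (subst (asm) ennreal_inj) (auto intro: sum_nonneg)
  also have "\<dots> \<le> (\<Sum>l\<in>\<Lambda>. c\<^sup>2)" by (intro sum_mono power_mono le) auto
  finally have "c * 1 \<le> c * (card \<Lambda> * c)" by (simp add: power2_eq_square mult_ac)
  then show False using c by simp
qed

lemma emeasure_density_lborel_singleton:
  "\<phi> \<in> borel_measurable borel \<Longrightarrow> emeasure (density lborel \<phi>) {x} = 0"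
  by (subst emeasure_density) (auto intro!: nn_integral_0_iff_AE[THEN iffD2] AE_I2 simp: nn_integral_null_set)

section \<open>Compactly supported measures with bounded density\<close>

lemma bessel_family_mono:
  assumes "bessel_family M I u B" "B \<le> C"
  shows "bessel_family M I u C"
proof -
  have "B * (\<integral>x. (cmod (f x))\<^sup>2 \<partial>M) \<le> C * (\<integral>x. (cmod (f x))\<^sup>2 \<partial>M)" for f
    using assms(2) by (intro mult_right_mono) auto
  then show ?thesis
    using assms(1) unfolding bessel_family_def by (meson order_trans)
qed

text \<open>Passing from Lebesgue measure to the uniform distribution on a cube around the support scales the
  density by the volume \<open>V\<close> of the cube. Outside the cube \<open>\<phi>\<close> vanishes almost everywhere, as \<open>\<mu>\<close> is
  concentrated on its support.\<close>

lemma bounded_density_F_spectrum: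
  fixes \<mu> :: "'a::euclidean_space measure" and \<phi> :: "'a \<Rightarrow> real"
  assumes \<phi>: "\<phi> \<in> borel_measurable borel" "\<And>x. 0 \<le> \<phi> x"
    and \<mu>: "\<mu> = density lborel (\<lambda>x. ennreal (\<phi> x))" and prob: "prob_space \<mu>"
    and supp: "compact (msupport \<mu>)" and m: "0 < m" "m \<le> M"
    and bounds: "AE x in lborel. x \<in> msupport \<mu> \<longrightarrow> m \<le> \<phi> x \<and> \<phi> x \<le> M"
  obtains \<Lambda> where "is_F_spectrum \<mu> \<Lambda>" "infinite \<Lambda>"
proof -
  note [measurable] = \<phi>(1)
  interpret mu: borel_prob \<mu>
    using prob by (intro borel_prob.intro borel_prob_axioms.intro) (auto simp: \<mu>)
  obtain R where R: "0 < R" "\<And>x. x \<in> msupport \<mu> \<Longrightarrow> norm x < R"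
    using compact_imp_bounded[OF supp] by (auto simp: bounded_pos_less)
  have cube: "msupport \<mu> \<subseteq> open_cube R"
  proof
    fix x assume "x \<in> msupport \<mu>"
    then show "x \<in> open_cube R"
      unfolding mem_open_cube using R(2)[of x] Basis_le_norm[of _ x] by (meson le_less_trans)
  qed
  interpret cube: borel_prob "cube_prob R :: 'a measure" using R(1) by (rule borel_prob_cube_prob)
  define V where "V = (2 * R) ^ DIM('a)"
  have V: "0 < V" using R by (simp add: V_def)
  have AE_supp: "AE x in lborel. 0 < \<phi> x \<longrightarrow> x \<in> msupport \<mu>"
    using mu.AE_msupport \<phi> unfolding \<mu> by (subst (asm) AE_density) auto
  have dens: "\<mu> = density (cube_prob R) (\<lambda>x. ennreal (V * \<phi> x))"
  proof -
    have "density (cube_prob R) (\<lambda>x. ennreal (V * \<phi> x))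
        = density lborel (\<lambda>x. ennreal (indicator (open_cube R) x / V) * ennreal (V * \<phi> x))"
      unfolding cube_prob_def V_def[symmetric] by (intro density_density_eq) auto
    also have "\<dots> = density lborel (\<lambda>x. ennreal (\<phi> x))"
    proof (rule density_cong)
      show "AE x in lborel. ennreal (indicator (open_cube R) x / V) * ennreal (V * \<phi> x) = ennreal (\<phi> x)"
        using AE_supp
      proof eventually_elim
        case (elim x)
        show ?case
        proof (cases "x \<in> open_cube R")
          case True
          then show ?thesis using V \<phi>(2)[of x] by (simp flip: ennreal_mult)
        next
          case False
          then have "\<phi> x = 0" using elim cube \<phi>(2)[of x] by force
          then show ?thesis by simp
        qed
      qed
    qed auto
    finally show ?thesis by (simp add: \<mu>)
  qed
  have sp: "is_spectrum (cube_prob R :: 'a measure) (cube_lattice R)"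
    using R(1) by (rule cube_lattice_spectrum)
  show thesis
  proof (rule that)
    show "is_F_spectrum \<mu> (cube_lattice R)"
    proof (rule cube.F_spectrum_of_bounded_density[OF sp _ _ dens])
      show "(\<lambda>x. V * \<phi> x) \<in> borel_measurable borel" by measurable
      show "0 \<le> V * \<phi> x" for x using V \<phi>(2) by simp
      have "AE x in \<mu>. m \<le> \<phi> x \<and> \<phi> x \<le> M"
        unfolding \<mu>
      proof (subst AE_density)
        show "AE x in lborel. 0 < ennreal (\<phi> x) \<longrightarrow> m \<le> \<phi> x \<and> \<phi> x \<le> M"
          using AE_supp bounds by eventually_elim auto
      qed simp
      then show "AE x in \<mu>. V * m \<le> V * \<phi> x \<and> V * \<phi> x \<le> V * M"
        by eventually_elim (use V in auto)
      show "0 < V * m" "V * m \<le> V * M" using V m by auto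
    qed
    show "infinite (cube_lattice R :: 'a set)"
    proof (rule cube.spectrum_infinite[OF _ sp])
      show "emeasure (cube_prob R) {x} = 0" for x :: 'a
        unfolding cube_prob_def by (intro emeasure_density_lborel_singleton) measurable
    qed
  qed
qed

theorem corollary3p19:
  fixes \<mu> :: "'a::euclidean_space measure" and \<phi> :: "'a \<Rightarrow> real" and m M :: real
  assumes "\<phi> \<in> borel_measurable borel" and "\<And>x. 0 \<le> \<phi> x"
    and "\<mu> = density lborel (\<lambda>x. ennreal (\<phi> x))"
    and "prob_space \<mu>"
    and "compact (msupport \<mu>)"
    and "0 < m" and "m \<le> M"
    and "AE x in lborel. x \<in> msupport \<mu> \<longrightarrow> m \<le> \<phi> x \<and> \<phi> x \<le> M"
  shows
    "(\<exists>\<Lambda>. countable \<Lambda> \<and> (is_spectrum \<mu> \<Lambda> \<or> is_F_spectrum \<mu> \<Lambda>) \<and>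
        emeasure (dirac_sum \<Lambda>) UNIV = \<infinity> \<and>
        (\<forall>(p::real) (q::ennreal). 1 \<le> p \<longrightarrow> p \<le> 2 \<longrightarrow> 1 / ennreal p + 1 / q = 1 \<longrightarrow>
           (\<exists>B. dirac_sum \<Lambda> \<in> bessel_measures \<mu> p q B))) \<and>
     (\<forall>\<Lambda>. is_spectrum \<mu> \<Lambda> \<longrightarrow>
        emeasure (dirac_sum \<Lambda>) UNIV = \<infinity> \<and>
        (\<forall>(p::real) (q::ennreal). 1 \<le> p \<longrightarrow> p \<le> 2 \<longrightarrow> 1 / ennreal p + 1 / q = 1 \<longrightarrow>
           dirac_sum \<Lambda> \<in> bessel_measures \<mu> p q 1)) \<and>
     (\<exists>\<Lambda>. countable \<Lambda> \<and> (is_spectrum \<mu> \<Lambda> \<or> is_F_spectrum \<mu> \<Lambda>) \<and>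
        (\<forall>(p::real) (q::real). 1 < p \<longrightarrow> p \<le> 2 \<longrightarrow> 1 / p + 1 / q = 1 \<longrightarrow>
           (\<exists>B. is_q_bessel \<mu> p q \<Lambda> expo B))) \<and>
     (\<forall>\<Lambda>. is_spectrum \<mu> \<Lambda> \<longrightarrow>
        (\<forall>(p::real) (q::real). 1 < p \<longrightarrow> p \<le> 2 \<longrightarrow> 1 / p + 1 / q = 1 \<longrightarrow>
           is_q_bessel \<mu> p q \<Lambda> expo 1))"
proof -
  interpret borel_prob \<mu>
    using assms(3,4) by (intro borel_prob.intro borel_prob_axioms.intro) auto
  have diffuse: "emeasure \<mu> {x} = 0" for x
    unfolding assms(3) using assms(1) by (intro emeasure_density_lborel_singleton) measurable
  obtain \<Lambda> where \<Lambda>: "is_F_spectrum \<mu> \<Lambda>" "infinite \<Lambda>"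
    using bounded_density_F_spectrum[OF assms] .
  then have ct: "countable \<Lambda>" by (simp add: is_F_spectrum_def)
  \<comment> \<open>Raising the Bessel bound to at least one makes it valid for \<open>p = 1\<close> as well.\<close>
  obtain B0 where "bessel_family \<mu> \<Lambda> expo B0" using F_spectrum_bessel_family[OF \<Lambda>(1)] .
  then have B: "bessel_family \<mu> \<Lambda> expo (max 1 B0)" by (rule bessel_family_mono) simp
  have inf: "emeasure (dirac_sum \<Lambda>) UNIV = \<infinity>" using \<Lambda>(2) by (rule emeasure_dirac_sum_UNIV)
  have meas: "dirac_sum \<Lambda> \<in> bessel_measures \<mu> p q (max 1 B0)"
    if "1 \<le> p" "p \<le> 2" "1 / ennreal p + 1 / q = 1" for p q
    by (rule hausdorff_young_bessel_measure[OF ct _ B that]) simp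
  have bes: "is_q_bessel \<mu> p q \<Lambda> expo (max 1 B0)"
    if "1 < p" "p \<le> 2" "1 / p + 1 / q = 1" for p q
    by (rule hausdorff_young_q_bessel[OF ct _ B that]) simp
  have spectral: "emeasure (dirac_sum S) UNIV = \<infinity>"
    "\<And>p q. 1 \<le> p \<Longrightarrow> p \<le> 2 \<Longrightarrow> 1 / ennreal p + 1 / q = 1 \<Longrightarrow> dirac_sum S \<in> bessel_measures \<mu> p q 1"
    "\<And>p q. 1 < p \<Longrightarrow> p \<le> 2 \<Longrightarrow> 1 / p + 1 / q = 1 \<Longrightarrow> is_q_bessel \<mu> p q S expo 1"
    if S: "is_spectrum \<mu> S" for S
  proof -
    have ctS: "countable S" using S by (simp add: is_spectrum_def)
    note BS = spectrum_bessel_family[OF S]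
    show "emeasure (dirac_sum S) UNIV = \<infinity>"
      using spectrum_infinite[OF diffuse S] by (rule emeasure_dirac_sum_UNIV)
    show "dirac_sum S \<in> bessel_measures \<mu> p q 1" if "1 \<le> p" "p \<le> 2" "1 / ennreal p + 1 / q = 1" for p q
      by (rule hausdorff_young_bessel_measure[OF ctS order_refl BS that])
    show "is_q_bessel \<mu> p q S expo 1" if "1 < p" "p \<le> 2" "1 / p + 1 / q = 1" for p q
      by (rule hausdorff_young_q_bessel[OF ctS zero_less_one BS that])
  qed
  show ?thesis
    using ct \<Lambda>(1) inf meas bes spectral by blast
qed

end
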